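(* Let $E$ and $E'$ be $\mathcal L_\infty$-spaces, let $Y,Z,Z'$ be Banach spaces, and let $0 \to Y \to E \to Z \to 0$ and $0\to Y \to E' \to Z' \to 0$ be two exact sequences of Banach spaces and bounded linear operators (with the same subspace $Y$). Then $Z$ has the BAP if and only if $Z'$ has the BAP.
   Context: A Banach space $X$ has the $\lambda$-BAP ($\lambda\ge 1$) if for each finite dimensional subspace $F\subset X$ there is a finite rank bounded operator $T:X\to X$ with $\|T\|\le \lambda$ and $T(f)=f$ for each $f\in F$. $X$ has the BAP (Bounded Approximation Property) if it has the $\lambda$-BAP for some $\lambda$. A Banach space $E$ is a $\mathcal L_\infty$-space if there is $\mu\ge 1$ such that every finite dimensional subspace of $E$ is contained in a finite dimensional subspace $G$ of $E$ whose Banach–Mazur distance to $\ell_\infty^{\dim G}$ is at most $\mu$. An exact sequence $0\to Y\to X\to Z\to 0$ of Banach spaces is a diagram of bounded linear operators in which the kernel of each arrow coincides with the image of the preceding one. *)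

theory Defs
  imports "HOL-Analysis.Analysis"
begin

definition fin_dim :: "'a::real_vector set \<Rightarrow> bool" where
  "fin_dim F \<longleftrightarrow> (\<exists>B. finite B \<and> F = span B)"

definition lambda_BAP :: "'a::banach itself \<Rightarrow> real \<Rightarrow> bool" where
  "lambda_BAP X L \<longleftrightarrow> L \<ge> 1 \<and>
     (\<forall>F::'a set. fin_dim F \<longrightarrow>
        (\<exists>T::'a \<Rightarrow> 'a. bounded_linear T \<and> fin_dim (range T) \<and> onorm T \<le> L \<and> (\<forall>f\<in>F. T f = f)))"

definition BAP :: "'a::banach itself \<Rightarrow> bool" where
  "BAP X \<longleftrightarrow> (\<exists>L. lambda_BAP X L)"

text \<open>
  Subspaces of normed spaces are represented as sets. The quotient below is 0 at the origin, so the
  supremum is the usual operator norm (including for the zero space), and it is infinite exactly for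
  unbounded maps.
\<close>

definition onorm_on :: "'a::real_normed_vector set \<Rightarrow> ('a \<Rightarrow> 'b::real_normed_vector) \<Rightarrow> ereal" where
  "onorm_on G T = (SUP x\<in>G. ereal (norm (T x) / norm x))"

definition linear_iso_on ::
    "'a::real_vector set \<Rightarrow> 'b::real_vector set \<Rightarrow> ('a \<Rightarrow> 'b) \<Rightarrow> bool" where
  "linear_iso_on G H T \<longleftrightarrow> bij_betw T G H \<and>
     (\<forall>x\<in>G. \<forall>y\<in>G. T (x + y) = T x + T y) \<and>
     (\<forall>c. \<forall>x\<in>G. T (c *\<^sub>R x) = c *\<^sub>R T x)"

text \<open>
  The multiplicative Banach-Mazur distance of two subspaces; it is infinite when they are not
  isomorphic.
\<close>

definition banach_mazur_dist ::
    "'a::real_normed_vector set \<Rightarrow> 'b::real_normed_vector set \<Rightarrow> ereal" where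
  "banach_mazur_dist G H =
     (INF T\<in>{T. linear_iso_on G H T}. onorm_on G T * onorm_on H (inv_into G T))"

text \<open>
  Since \<open>nat\<close> is discrete, \<open>nat \<Rightarrow>\<^sub>C real\<close> is the space of all bounded real sequences with the
  supremum norm; the sequences vanishing from index \<open>n\<close> on form an isometric copy of \<open>n\<close>-dimensional
  real space with the maximum norm.
\<close>

definition ell_infty :: "nat \<Rightarrow> (nat \<Rightarrow>\<^sub>C real) set" where
  "ell_infty n = {f. \<forall>i\<ge>n. apply_bcontfun f i = 0}"

definition L_infty_space :: "'a::banach itself \<Rightarrow> bool" where
  "L_infty_space E \<longleftrightarrow>
     (\<exists>\<mu>::real. \<mu> \<ge> 1 \<and>
        (\<forall>F::'a set. fin_dim F \<longrightarrow>
           (\<exists>G. fin_dim G \<and> F \<subseteq> G \<and> banach_mazur_dist G (ell_infty (dim G)) \<le> ereal \<mu>)))"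

text \<open>
  Exactness of \<open>0 \<rightarrow> Y \<rightarrow> X \<rightarrow> Z \<rightarrow> 0\<close> at \<open>Y\<close>, at \<open>X\<close> and at \<open>Z\<close>.
\<close>

definition short_exact :: "('y::banach \<Rightarrow> 'x::banach) \<Rightarrow> ('x \<Rightarrow> 'z::banach) \<Rightarrow> bool" where
  "short_exact j q \<longleftrightarrow> bounded_linear j \<and> bounded_linear q \<and>
     {y. j y = 0} = {0} \<and> {x. q x = 0} = range j \<and> range q = UNIV"

end

theory Submission
  imports Defs
begin

text \<open>
  Write \<open>X\<close> for the pushout of the two embeddings \<open>j : Y \<rightarrow> E\<close> and \<open>j' : Y \<rightarrow> E'\<close>. It is the
  middle of two exact sequences, one with subspace \<open>E'\<close> and quotient \<open>Z\<close>, the other with subspace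
  \<open>E\<close> and quotient \<open>Z'\<close>. So it is enough to know that, for an extension \<open>X\<close> of a Banach space
  \<open>Z\<close> by an L-infinity space \<open>E\<close>, the space \<open>X\<close> has the BAP if and only if \<open>Z\<close> has it
  (lemmas \<open>BAP_extension\<close> and \<open>BAP_quotient\<close>): then \<open>Z\<close>, \<open>X\<close> and \<open>Z'\<close> have it together.

  What makes an L-infinity space special is that, by the Hahn-Banach theorem applied coordinatewise,
  every finite-rank operator from a subspace of \<open>X\<close> into \<open>E\<close> extends to a finite-rank operator on
  \<open>X\<close> with control of the norm (lemma \<open>L_infty_space_extension\<close>). Hence a finite-dimensional
  subspace of \<open>E\<close> is fixed by some finite-rank operator \<open>P : X \<rightarrow> E\<close> of bounded norm. Correcting
  an arbitrary linear lifting by such a \<open>P\<close> shows that the quotient map \<open>q : X \<rightarrow> Z\<close> has linear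
  liftings on finite-dimensional subspaces with a uniform bound (lemma \<open>uniform_lifting\<close>).

  From \<open>Z\<close> to \<open>X\<close>: if \<open>T\<close> is a finite-rank operator on \<open>Z\<close> that fixes \<open>q F\<close> and \<open>s\<close> lifts the
  range of \<open>T\<close>, then \<open>V = s T q\<close> satisfies \<open>x - V x \<in> E\<close> for \<open>x \<in> F\<close>. If \<open>P\<close> fixes these
  differences, \<open>V + P (1 - V)\<close> fixes \<open>F\<close>.

  From \<open>X\<close> to \<open>Z\<close>: let \<open>s\<close> lift \<open>F \<subseteq> Z\<close> and let \<open>T\<close> be a finite-rank operator on \<open>X\<close> that fixes
  \<open>s F\<close>. For finite-dimensional \<open>B \<subseteq> E\<close> choose \<open>P\<close> that is the identity on \<open>B\<close> and zero on \<open>s F\<close>,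
  again with a bound independent of \<open>B\<close>. The operators \<open>q T (1 - P) : X \<rightarrow> Z\<close> vanish on \<open>B\<close>, send
  \<open>s f\<close> to \<open>f\<close> for \<open>f \<in> F\<close>, are uniformly bounded and have values in one finite-dimensional space. By
  Tychonoff's theorem they have a limit as \<open>B\<close> grows, which vanishes on \<open>E\<close> and so factors
  through \<open>Z\<close> to an operator that fixes \<open>F\<close>.

  The pushout is a quotient of \<open>E \<times> E'\<close> by a subspace that depends on \<open>j\<close> and \<open>j'\<close>, while a type
  cannot depend on them. It is therefore represented by the space \<open>E \<times> E'\<close> with the quotient seminorm, and the
  argument above is carried out for a seminormed space \<open>X\<close>, where elements at distance zero count as equal.
\<close>

section \<open>Finite-dimensional subspaces of a normed space\<close>

lemma span_insert_decomp:
  assumes "x \<in> span (insert b B)"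
  obtains t w where "w \<in> span B" "x = t *\<^sub>R b + w"
proof -
  obtain k where "x - k *\<^sub>R b \<in> span B" using assms by (auto simp: span_insert)
  then show ?thesis using that[of "x - k *\<^sub>R b" k] by simp
qed

text \<open>
  A convergent sequence is bounded, so it lies in one of the compact, hence closed, pieces.
\<close>

lemma closed_if_compact_balls:
  fixes S :: "'a::real_normed_vector set"
  assumes "\<And>r. compact (S \<inter> cball 0 r)"
  shows "closed S"
  unfolding closed_sequential_limits
proof (intro allI impI)
  fix x l assume A: "(\<forall>n. x n \<in> S) \<and> x \<longlonglongrightarrow> l"
  then have "Bseq x" using convergentI convergent_imp_Bseq by blast
  then obtain r where r: "\<And>n. norm (x n) \<le> r" by (auto simp: Bseq_def)
  have "closed (S \<inter> cball 0 r)" using assms compact_imp_closed by blast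
  moreover have "\<forall>n. x n \<in> S \<inter> cball 0 r" using A r by auto
  ultimately have "l \<in> S \<inter> cball 0 r" using A unfolding closed_sequential_limits by blast
  then show "l \<in> S" by simp
qed

text \<open>
  The constant is the distance of \<open>b\<close> from the closed subspace \<open>span B\<close>: if \<open>t \<noteq> 0\<close>, then
  \<open>t b + w\<close> is \<open>t\<close> times the difference of \<open>b\<close> and an element of \<open>span B\<close>.
\<close>

lemma span_coefficient_bound:
  fixes b :: "'a::real_normed_vector"
  assumes "closed (span B)" "b \<notin> span B"
  obtains d where "d > 0" "\<And>t w. w \<in> span B \<Longrightarrow> d * \<bar>t\<bar> \<le> norm (t *\<^sub>R b + w)"
proof
  let ?d = "infdist b (span B)"
  have "span B \<noteq> {}" using span_zero by blast
  then show "?d > 0" using assms infdist_pos_not_in_closed by blast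
  fix t w assume w: "w \<in> span B"
  show "?d * \<bar>t\<bar> \<le> norm (t *\<^sub>R b + w)"
  proof (cases "t = 0")
    case False
    have "(-1/t) *\<^sub>R w \<in> span B" using w span_scale by blast
    then have "?d \<le> norm (b - (-1/t) *\<^sub>R w)" using infdist_le dist_norm by metis
    then have "?d * \<bar>t\<bar> \<le> norm (b - (-1/t) *\<^sub>R w) * \<bar>t\<bar>" by (simp add: mult_right_mono)
    also have "\<dots> = norm (t *\<^sub>R (b - (-1/t) *\<^sub>R w))" by simp
    also have "t *\<^sub>R (b - (-1/t) *\<^sub>R w) = t *\<^sub>R b + w" using False by (simp add: algebra_simps)
    finally show ?thesis .
  qed simp
qed

text \<open>
  Heine-Borel for finite-dimensional subspaces of a space that may itself be infinite-dimensional.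
  Adding a new basis vector, the coefficient bound presents the ball as a closed part of a
  continuous image of a compact product.
\<close>

lemma compact_span_Int_cball:
  fixes B :: "'a::real_normed_vector set"
  assumes "finite B"
  shows "compact (span B \<inter> cball 0 r)"
  using assms
proof (induction B arbitrary: r rule: finite_induct)
  case empty
  have "{0::'a} \<inter> cball 0 r = {0} \<or> {0::'a} \<inter> cball 0 r = {}" by auto
  then show ?case by (metis span_empty compact_empty compact_insert)
next
  case (insert b B)
  show ?case
  proof (cases "b \<in> span B")
    case True
    then show ?thesis using insert.IH by (simp add: span_redundant)
  next
    case False
    have "closed (span B)" by (rule closed_if_compact_balls) (rule insert.IH)
    then obtain d where d: "d > 0" "\<And>t w. w \<in> span B \<Longrightarrow> d * \<bar>t\<bar> \<le> norm (t *\<^sub>R b + w)"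
      using False span_coefficient_bound by blast
    let ?r = "r + r / d * norm b"
    let ?f = "\<lambda>(t::real, w). t *\<^sub>R b + w"
    have "compact (?f ` (cball 0 (r/d) \<times> (span B \<inter> cball 0 ?r)))"
      by (intro compact_continuous_image compact_Times insert.IH compact_cball)
        (auto simp: split_def intro!: continuous_intros)
    then have "compact (?f ` (cball 0 (r/d) \<times> (span B \<inter> cball 0 ?r)) \<inter> cball 0 r)"
      by (simp add: compact_Int_closed)
    moreover have "?f ` (cball 0 (r/d) \<times> (span B \<inter> cball 0 ?r)) \<inter> cball 0 r
        = span (insert b B) \<inter> cball 0 r" (is "?L = ?R")
    proof
      show "?L \<subseteq> ?R"
        using span_mono[OF subset_insertI, of B b]
        by (auto simp: split_def intro!: span_add span_scale intro: span_base)
      show "?R \<subseteq> ?L"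
      proof
        fix x assume x: "x \<in> ?R"
        then obtain t w where w: "w \<in> span B" "x = t *\<^sub>R b + w"
          using span_insert_decomp by blast
        have "d * \<bar>t\<bar> \<le> r" using d(2)[OF w(1), of t] w(2) x by auto
        then have t: "\<bar>t\<bar> \<le> r / d" using d(1) by (simp add: field_simps)
        have "norm w = norm (x - t *\<^sub>R b)" using w(2) by simp
        also have "\<dots> \<le> norm x + \<bar>t\<bar> * norm b"
          by (metis norm_triangle_ineq4 norm_scaleR)
        also have "\<dots> \<le> ?r"
          using x mult_right_mono[OF t norm_ge_zero[of b]] by auto
        finally show "x \<in> ?L" using w t x by (auto intro!: image_eqI[where x="(t,w)"])
      qed
    qed
    ultimately show ?thesis by simp
  qed
qed

lemma closed_span_finite:
  fixes B :: "'a::real_normed_vector set"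
  shows "finite B \<Longrightarrow> closed (span B)"
  by (rule closed_if_compact_balls) (rule compact_span_Int_cball)

lemma fin_dim_compact_Int_cball:
  "fin_dim (F::'a::real_normed_vector set) \<Longrightarrow> compact (F \<inter> cball 0 r)"
  by (auto simp: fin_dim_def compact_span_Int_cball)

lemma fin_dim_imp_subspace: "fin_dim F \<Longrightarrow> subspace F"
  by (auto simp: fin_dim_def)

lemma fin_dim_span: "finite B \<Longrightarrow> fin_dim (span B)"
  by (auto simp: fin_dim_def)

lemma fin_dim_subset:
  assumes "fin_dim G" "subspace F" "F \<subseteq> G"
  shows "fin_dim F"
proof -
  obtain B where B: "finite B" "G = span B" using assms by (auto simp: fin_dim_def)
  obtain C where C: "C \<subseteq> F" "independent C" "F \<subseteq> span C"
    using maximal_independent_subset by blast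
  have "finite C" using independent_span_bound[OF B(1) C(2)] B C assms by auto
  moreover have "F = span C" using C assms by (metis span_minimal subset_antisym)
  ultimately show ?thesis by (auto simp: fin_dim_def)
qed

lemma fin_dim_linear_image:
  assumes "linear f" "fin_dim F"
  shows "fin_dim (f ` F)"
proof -
  obtain B where B: "finite B" "F = span B" using assms by (auto simp: fin_dim_def)
  then have "f ` F = span (f ` B)" using linear_span_image[OF assms(1)] by simp
  then show ?thesis using B by (auto simp: fin_dim_def)
qed

lemma fin_dim_basis:
  assumes "fin_dim F"
  obtains B where "finite B" "independent B" "F = span B"
proof -
  obtain C where C: "finite C" "F = span C" using assms by (auto simp: fin_dim_def)
  then show ?thesis
    using maximal_independent_subset[of C] that
    by (metis finite_subset span_eq span_superset subset_trans)
qed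

lemma fin_dim_sums:
  assumes "fin_dim F" "fin_dim G"
  shows "fin_dim {x + y |x y. x \<in> F \<and> y \<in> G}"
proof -
  obtain B C where "finite B" "F = span B" "finite C" "G = span C"
    using assms by (auto simp: fin_dim_def)
  then have "{x + y |x y. x \<in> F \<and> y \<in> G} = span (B \<union> C)" "finite (B \<union> C)"
    by (auto simp: span_Un)
  then show ?thesis by (auto simp: fin_dim_def)
qed

definition seminorm :: "('a::real_vector \<Rightarrow> real) \<Rightarrow> bool" where
  "seminorm p \<longleftrightarrow> (\<forall>x y. p (x + y) \<le> p x + p y) \<and> (\<forall>c x. p (c *\<^sub>R x) = \<bar>c\<bar> * p x)"

lemma seminorm_add: "seminorm p \<Longrightarrow> p (x + y) \<le> p x + p y"
  and seminorm_scale: "seminorm p \<Longrightarrow> p (c *\<^sub>R x) = \<bar>c\<bar> * p x"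
  by (auto simp: seminorm_def)

lemma seminorm_zero: "seminorm p \<Longrightarrow> p 0 = 0"
  using seminorm_scale[of p 0 0] by simp

lemma seminorm_minus: "seminorm p \<Longrightarrow> p (- x) = p x"
  using seminorm_scale[of p "-1" x] by simp

lemma seminorm_diff: "seminorm p \<Longrightarrow> p (x - y) \<le> p x + p y"
  using seminorm_add[of p x "- y"] seminorm_minus[of p y] by simp

lemma seminorm_nonneg: "seminorm p \<Longrightarrow> 0 \<le> p x"
  using seminorm_add[of p x "- x"] seminorm_minus[of p x] seminorm_zero[of p] by simp

lemma linear_bounded_on_span:
  fixes f :: "'a::real_normed_vector \<Rightarrow> 'b::real_vector"
  assumes "finite B" "linear f" "seminorm p"
  shows "\<exists>C\<ge>0. \<forall>x\<in>span B. p (f x) \<le> C * norm x"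
  using assms(1)
proof (induction B rule: finite_induct)
  case empty
  then show ?case using assms by (auto simp: linear_0 seminorm_zero)
next
  case (insert b B)
  then obtain C where C: "C \<ge> 0" "\<And>x. x \<in> span B \<Longrightarrow> p (f x) \<le> C * norm x" by auto
  show ?case
  proof (cases "b \<in> span B")
    case True
    then show ?thesis using C by (auto simp: span_redundant)
  next
    case False
    then obtain d where d: "d > 0" "\<And>t w. w \<in> span B \<Longrightarrow> d * \<bar>t\<bar> \<le> norm (t *\<^sub>R b + w)"
      using closed_span_finite[OF insert(1)] span_coefficient_bound by blast
    \<comment> \<open>the two terms bound \<open>p (f (t b))\<close> and \<open>p (f w)\<close> for \<open>x = t b + w\<close>\<close>
    let ?C = "p (f b) / d + C * (1 + norm b / d)"
    have "p (f x) \<le> ?C * norm x" if "x \<in> span (insert b B)" for x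
    proof -
      note x = that
      obtain t w where w: "w \<in> span B" "x = t *\<^sub>R b + w"
        using x span_insert_decomp by blast
      have t: "\<bar>t\<bar> \<le> norm x / d" using d(2)[OF w(1), of t] w d(1) by (simp add: field_simps)
      have "norm w = norm (x - t *\<^sub>R b)" using w(2) by simp
      also have "\<dots> \<le> norm x + \<bar>t\<bar> * norm b" by (metis norm_triangle_ineq4 norm_scaleR)
      also have "\<dots> \<le> norm x + norm x / d * norm b" by (intro add_mono mult_right_mono t) auto
      finally have nw: "norm w \<le> norm x + norm x / d * norm b" .
      have "p (f x) = p (t *\<^sub>R f b + f w)"
        using w(2) assms(2) by (simp add: linear_add linear_scale)
      also have "\<dots> \<le> \<bar>t\<bar> * p (f b) + p (f w)"
        using seminorm_add[OF assms(3)] seminorm_scale[OF assms(3)] by metis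
      also have "\<dots> \<le> norm x / d * p (f b) + C * (norm x + norm x / d * norm b)"
        using C(2)[OF w(1)] mult_left_mono[OF nw C(1)]
          mult_right_mono[OF t seminorm_nonneg[OF assms(3), of "f b"]] by linarith
      also have "\<dots> = ?C * norm x" by (simp add: algebra_simps)
      finally show ?thesis .
    qed
    moreover have "?C \<ge> 0" using C d seminorm_nonneg[OF assms(3)] by (simp add: add_nonneg_nonneg)
    ultimately show ?thesis by blast
  qed
qed

lemma linear_bounded_on_fin_dim:
  fixes f :: "'a::real_normed_vector \<Rightarrow> 'b::real_vector"
  assumes "fin_dim F" "linear f" "seminorm p"
  obtains C where "C \<ge> 0" "\<And>x. x \<in> F \<Longrightarrow> p (f x) \<le> C * norm x"
  using linear_bounded_on_span[OF _ assms(2,3)] assms(1) unfolding fin_dim_def by metis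

section \<open>The Hahn-Banach theorem\<close>

text \<open>
  Hahn-Banach is obtained from the fact that a minimal sublinear functional is linear; domination and
  the prescribed values are put together into a single sublinear functional beforehand.
\<close>

definition sublinear :: "('a::real_vector \<Rightarrow> real) \<Rightarrow> bool" where
  "sublinear p \<longleftrightarrow> (\<forall>x y. p (x + y) \<le> p x + p y) \<and> (\<forall>c\<ge>0. \<forall>x. p (c *\<^sub>R x) = c * p x)"

lemma sublinear_add: "sublinear p \<Longrightarrow> p (x + y) \<le> p x + p y"
  and sublinear_scale: "sublinear p \<Longrightarrow> c \<ge> 0 \<Longrightarrow> p (c *\<^sub>R x) = c * p x"
  by (auto simp: sublinear_def)

lemma sublinear_zero: "sublinear p \<Longrightarrow> p 0 = 0"
  using sublinear_scale[of p 0 0] by simp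

lemma sublinear_lower: "sublinear p \<Longrightarrow> - p (- x) \<le> p x"
  using sublinear_add[of p x "- x"] sublinear_zero[of p] by simp

lemma sublinearI:
  assumes "\<And>x y. p (x + y) \<le> p x + p y" "\<And>c x. c > 0 \<Longrightarrow> p (c *\<^sub>R x) \<le> c * p x" "p 0 = 0"
  shows "sublinear p"
proof -
  have "p (c *\<^sub>R x) = c * p x" if "c \<ge> 0" for c x
  proof (cases "c = 0")
    case False
    then have c: "c > 0" using that by simp
    have "p x = p ((1/c) *\<^sub>R (c *\<^sub>R x))" using c by simp
    also have "\<dots> \<le> (1/c) * p (c *\<^sub>R x)" using assms(2)[of "1/c"] c by (metis zero_less_divide_1_iff)
    finally have "c * p x \<le> p (c *\<^sub>R x)" using c by (simp add: field_simps)
    then show ?thesis using assms(2)[OF c, of x] by simp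
  qed (simp add: assms)
  then show ?thesis using assms by (auto simp: sublinear_def)
qed

text \<open>
  The infimum is finite because every \<open>g \<le> p\<close> satisfies \<open>g x \<ge> - g (- x) \<ge> - p (- x)\<close>. Subadditivity
  uses that of two members of a chain one is smaller.
\<close>

lemma sublinear_chain_Inf:
  fixes C :: "('a::real_vector \<Rightarrow> real) set"
  assumes "C \<noteq> {}" "\<And>g. g \<in> C \<Longrightarrow> sublinear g \<and> g \<le> p" "sublinear p"
    "\<And>g h. g \<in> C \<Longrightarrow> h \<in> C \<Longrightarrow> g \<le> h \<or> h \<le> g"
  shows "sublinear (\<lambda>x. INF g\<in>C. g x)" "\<And>g. g \<in> C \<Longrightarrow> (\<lambda>x. INF g\<in>C. g x) \<le> g"
proof -
  let ?I = "\<lambda>x. INF g\<in>C. g x"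
  have bdd: "bdd_below ((\<lambda>g. g x) ` C)" for x
  proof (rule bdd_belowI2)
    fix g assume g: "g \<in> C"
    have "- p (- x) \<le> - g (- x)" using assms(2)[OF g] by (simp add: le_fun_def)
    also have "\<dots> \<le> g x" using sublinear_lower assms(2)[OF g] by blast
    finally show "- p (- x) \<le> g x" .
  qed
  have low: "?I x \<le> g x" if "g \<in> C" for g x
    using cINF_lower[OF bdd that] .
  then show "\<And>g. g \<in> C \<Longrightarrow> ?I \<le> g" by (simp add: le_fun_def)
  show "sublinear ?I"
  proof (rule sublinearI)
    fix x y
    have "?I (x + y) - h y \<le> g x" if gh: "g \<in> C" "h \<in> C" for g h
    proof -
      obtain k where k: "k \<in> C" "k \<le> g" "k \<le> h" using assms(4)[OF gh] gh by blast
      have "?I (x + y) \<le> k (x + y)" by (rule low[OF k(1)])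
      also have "\<dots> \<le> k x + k y" using assms(2)[OF k(1)] sublinear_add by blast
      also have "\<dots> \<le> g x + h y" using k by (simp add: le_fun_def add_mono)
      finally show ?thesis by simp
    qed
    then have *: "?I (x + y) - h y \<le> ?I x" if "h \<in> C" for h
      using that by (intro cINF_greatest assms(1))
    have "?I (x + y) - ?I x \<le> h y" if "h \<in> C" for h
      using *[OF that] by linarith
    then have "?I (x + y) - ?I x \<le> ?I y"
      by (intro cINF_greatest assms(1))
    then show "?I (x + y) \<le> ?I x + ?I y" by simp
  next
    fix c :: real and x assume c: "c > 0"
    have "?I (c *\<^sub>R x) / c \<le> g x" if "g \<in> C" for g
      using low[OF that, of "c *\<^sub>R x"] assms(2)[OF that] sublinear_scale[of g c x] c
      by (simp add: field_simps)
    then have "?I (c *\<^sub>R x) / c \<le> ?I x" by (intro cINF_greatest assms(1)) auto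
    then show "?I (c *\<^sub>R x) \<le> c * ?I x" using c by (simp add: field_simps)
  next
    have "?I 0 = (INF g\<in>C. 0)" using assms(2) sublinear_zero by (intro INF_cong) auto
    then show "?I 0 = 0" using assms(1) by simp
  qed
qed

text \<open>
  For fixed \<open>y\<close>, the functional \<open>x \<mapsto> inf (q (x + t y) - t q y)\<close> over \<open>t \<ge> 0\<close> is sublinear and below
  \<open>q\<close>, so it equals \<open>q\<close> by minimality. The value at \<open>t = 1\<close> gives \<open>q x + q y \<le> q (x + y)\<close>, the
  missing half of additivity.
\<close>

lemma minimal_sublinear_linear:
  assumes q: "sublinear q" and min: "\<And>g. sublinear g \<Longrightarrow> g \<le> q \<Longrightarrow> g = q"
  shows "linear q"
proof -
  have add: "q x + q y \<le> q (x + y)" for x y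
  proof -
    let ?g = "\<lambda>x. INF t\<in>{0..}. q (x + t *\<^sub>R y) - t * q y"
    have lower: "- q (- x) \<le> q (x + t *\<^sub>R y) - t * q y" if "t \<in> {0..}" for x t
      using sublinear_add[OF q, of "x + t *\<^sub>R y" "- x"] sublinear_scale[OF q, of t y] that by simp
    have bdd: "bdd_below ((\<lambda>t. q (x + t *\<^sub>R y) - t * q y) ` {0..})" for x
      using lower by (rule bdd_belowI2)
    have low: "?g x \<le> q (x + t *\<^sub>R y) - t * q y" if "t \<ge> 0" for x t
      using that by (intro cINF_lower[OF bdd]) auto
    have "?g \<le> q" using low[of 0] by (simp add: le_fun_def)
    moreover have "sublinear ?g"
    proof (rule sublinearI)
      fix x1 x2
      have *: "?g (x1 + x2) - (q (x2 + s *\<^sub>R y) - s * q y) \<le> q (x1 + t *\<^sub>R y) - t * q y"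
        if "s \<in> {0..}" "t \<in> {0..}" for s t
      proof -
        have "?g (x1 + x2) \<le> q ((x1 + x2) + (t + s) *\<^sub>R y) - (t + s) * q y"
          using that by (intro low) auto
        also have "(x1 + x2) + (t + s) *\<^sub>R y = (x1 + t *\<^sub>R y) + (x2 + s *\<^sub>R y)"
          by (simp add: algebra_simps)
        finally show ?thesis
          using sublinear_add[OF q, of "x1 + t *\<^sub>R y" "x2 + s *\<^sub>R y"] by (simp add: algebra_simps)
      qed
      then have **: "?g (x1 + x2) - (q (x2 + s *\<^sub>R y) - s * q y) \<le> ?g x1" if "s \<in> {0..}" for s
        using that by (intro cINF_greatest) auto
      have "?g (x1 + x2) - ?g x1 \<le> q (x2 + s *\<^sub>R y) - s * q y" if "s \<in> {0..}" for s
        using **[OF that] by linarith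
      then have "?g (x1 + x2) - ?g x1 \<le> ?g x2" by (intro cINF_greatest) auto
      then show "?g (x1 + x2) \<le> ?g x1 + ?g x2" by simp
    next
      fix c :: real and x assume c: "c > 0"
      have "?g (c *\<^sub>R x) / c \<le> q (x + t *\<^sub>R y) - t * q y" if "t \<in> {0..}" for t
      proof -
        have "?g (c *\<^sub>R x) \<le> q (c *\<^sub>R x + (c * t) *\<^sub>R y) - (c * t) * q y"
          using that c by (intro low) auto
        also have "c *\<^sub>R x + (c * t) *\<^sub>R y = c *\<^sub>R (x + t *\<^sub>R y)" by (simp add: algebra_simps)
        also have "q \<dots> = c * q (x + t *\<^sub>R y)" using sublinear_scale[OF q] c by simp
        finally show ?thesis using c by (simp add: field_simps)
      qed
      then have "?g (c *\<^sub>R x) / c \<le> ?g x" by (intro cINF_greatest) auto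
      then show "?g (c *\<^sub>R x) \<le> c * ?g x" using c by (simp add: field_simps)
    next
      have "?g 0 = (INF t\<in>{0::real..}. 0)"
        using sublinear_scale[OF q] by (intro INF_cong) auto
      then show "?g 0 = 0" by simp
    qed
    ultimately have "?g = q" using min by blast
    then have "?g x = q x" by (rule fun_cong)
    then show ?thesis using low[of 1 x] by simp
  qed
  then have add': "q (x + y) = q x + q y" for x y
    using sublinear_add[OF q] by (metis order_antisym)
  have neg: "q (- x) = - q x" for x
    using add'[of x "- x"] sublinear_zero[OF q] by simp
  show ?thesis
  proof (rule linearI)
    fix c x
    show "q (c *\<^sub>R x) = c *\<^sub>R q x"
    proof (cases "c \<ge> 0")
      case False
      then have "q (- (c *\<^sub>R x)) = - (c * q x)" using sublinear_scale[OF q, of "- c" x] by simp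
      then show ?thesis using neg[of "c *\<^sub>R x"] by simp
    qed (simp add: sublinear_scale[OF q])
  qed (rule add')
qed

lemma linear_below_sublinear:
  fixes p :: "'a::real_vector \<Rightarrow> real"
  assumes p: "sublinear p"
  obtains g where "linear g" "g \<le> p"
proof -
  let ?A = "{g. sublinear g \<and> g \<le> p}"
  have "\<exists>m\<in>?A. \<forall>g\<in>?A. g \<le> m \<longrightarrow> g = m"
  proof (rule predicate_Zorn[where P="\<lambda>g h. h \<le> g"])
    show "partial_order_on ?A (relation_of (\<lambda>g h. h \<le> g) ?A)"
      by (rule partial_order_on_relation_ofI) auto
  next
    fix C assume C: "C \<in> Chains (relation_of (\<lambda>g h. h \<le> g) ?A)"
    then have CA: "\<And>g. g \<in> C \<Longrightarrow> sublinear g \<and> g \<le> p"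
      and ch: "\<And>g h. g \<in> C \<Longrightarrow> h \<in> C \<Longrightarrow> g \<le> h \<or> h \<le> g"
      by (auto simp: Chains_def relation_of_def)
    show "\<exists>u\<in>?A. \<forall>a\<in>C. u \<le> a"
    proof (cases "C = {}")
      case True
      then show ?thesis using p by auto
    next
      case False
      have I: "sublinear (\<lambda>x. INF g\<in>C. g x)"
        by (rule sublinear_chain_Inf(1)[OF False _ p]) (use CA ch in blast)+
      have low: "(\<lambda>x. INF g\<in>C. g x) \<le> g" if "g \<in> C" for g
        by (rule sublinear_chain_Inf(2)[OF False _ p _ that]) (use CA ch in blast)+
      obtain g where g: "g \<in> C" using False by blast
      have "(\<lambda>x. INF g\<in>C. g x) \<le> p" using order_trans[OF low[OF g]] CA[OF g] by simp
      then have "(\<lambda>x. INF g\<in>C. g x) \<in> ?A" using I by simp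
      then show ?thesis by (rule bexI[rotated]) (intro ballI low)
    qed
  qed
  then obtain m where m: "sublinear m" "m \<le> p"
    and min: "\<And>g. sublinear g \<Longrightarrow> g \<le> p \<Longrightarrow> g \<le> m \<Longrightarrow> g = m" by blast
  have "linear m"
  proof (rule minimal_sublinear_linear[OF m(1)])
    fix g assume "sublinear g" "g \<le> m"
    then show "g = m" using min m(2) order_trans by metis
  qed
  then show ?thesis using that m(2) by blast
qed

text \<open>
  The functional to be extended is given by its graph \<open>\<Gamma>\<close>, which avoids functions that are linear only
  on a subspace.

  A linear functional below \<open>x \<mapsto> inf (p (x - d) + r)\<close>, the infimum over \<open>(d, r) \<in> \<Gamma>\<close>, is below \<open>p\<close> and,
  on \<open>\<Gamma>\<close>, below the prescribed values; by linearity it agrees with them.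
\<close>

lemma Hahn_Banach_relation:
  fixes p :: "'a::real_vector \<Rightarrow> real" and \<Gamma> :: "('a \<times> real) set"
  assumes p: "sublinear p" and \<Gamma>: "subspace \<Gamma>" and dom: "\<And>x r. (x, r) \<in> \<Gamma> \<Longrightarrow> r \<le> p x"
  obtains g where "linear g" "\<And>x. g x \<le> p x" "\<And>x r. (x, r) \<in> \<Gamma> \<Longrightarrow> g x = r"
proof -
  let ?q = "\<lambda>x. INF (d, r)\<in>\<Gamma>. p (x - d) + r"
  have ne: "\<Gamma> \<noteq> {}" using subspace_0[OF \<Gamma>] by blast
  have neg: "(- d, - r) \<in> \<Gamma>" if "(d, r) \<in> \<Gamma>" for d r
    using subspace_neg[OF \<Gamma> that] by simp
  have bdd: "bdd_below ((\<lambda>(d, r). p (x - d) + r) ` \<Gamma>)" for x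
  proof (rule bdd_belowI2)
    fix z assume z: "z \<in> \<Gamma>"
    obtain d r where dr: "z = (d, r)" by fastforce
    have "- r \<le> p (- d)" using dom[OF neg] z dr by blast
    also have "\<dots> \<le> p (x - d) + p (- x)" using sublinear_add[OF p, of "x - d" "- x"] by simp
    finally show "- p (- x) \<le> (case z of (d, r) \<Rightarrow> p (x - d) + r)" using dr by simp
  qed
  have low: "?q x \<le> p (x - d) + r" if "(d, r) \<in> \<Gamma>" for x d r
    using cINF_lower[OF bdd that, of x] by simp
  have great: "a \<le> ?q x" if "\<And>d r. (d, r) \<in> \<Gamma> \<Longrightarrow> a \<le> p (x - d) + r" for a x
    using that by (intro cINF_greatest ne) auto
  have "sublinear ?q"
  proof (rule sublinearI)
    fix x y
    have *: "?q (x + y) - (p (y - e) + s) \<le> p (x - d) + r" if "(d, r) \<in> \<Gamma>" "(e, s) \<in> \<Gamma>" for d r e s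
    proof -
      have "(d + e, r + s) \<in> \<Gamma>" using subspace_add[OF \<Gamma> that] by simp
      then have "?q (x + y) \<le> p ((x + y) - (d + e)) + (r + s)" by (rule low)
      also have "(x + y) - (d + e) = (x - d) + (y - e)" by simp
      finally show ?thesis using sublinear_add[OF p, of "x - d" "y - e"] by linarith
    qed
    have **: "?q (x + y) - (p (y - e) + s) \<le> ?q x" if "(e, s) \<in> \<Gamma>" for e s
      by (rule great) (rule *[OF _ that])
    have "?q (x + y) - ?q x \<le> ?q y"
    proof (rule great)
      fix e s assume "(e, s) \<in> \<Gamma>"
      then show "?q (x + y) - ?q x \<le> p (y - e) + s" using **[of e s] by linarith
    qed
    then show "?q (x + y) \<le> ?q x + ?q y" by simp
  next
    fix c :: real and x assume c: "c > 0"
    have "?q (c *\<^sub>R x) / c \<le> p (x - d) + r" if "(d, r) \<in> \<Gamma>" for d r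
    proof -
      have "(c *\<^sub>R d, c * r) \<in> \<Gamma>" using subspace_scale[OF \<Gamma> that, of c] by simp
      then have "?q (c *\<^sub>R x) \<le> p (c *\<^sub>R x - c *\<^sub>R d) + c * r" by (rule low)
      also have "c *\<^sub>R x - c *\<^sub>R d = c *\<^sub>R (x - d)" by (simp add: algebra_simps)
      also have "p \<dots> = c * p (x - d)" using sublinear_scale[OF p] c by simp
      finally show ?thesis using c by (simp add: field_simps)
    qed
    then have "?q (c *\<^sub>R x) / c \<le> ?q x" by (rule great)
    then show "?q (c *\<^sub>R x) \<le> c * ?q x" using c by (simp add: field_simps)
  next
    have "?q 0 \<le> p (0 - 0) + 0" by (rule low) (use subspace_0[OF \<Gamma>] in \<open>simp add: zero_prod_def\<close>)
    moreover have "0 \<le> ?q 0"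
    proof (rule great)
      fix d r assume "(d, r) \<in> \<Gamma>"
      then show "0 \<le> p (0 - d) + r" using dom[OF neg, of d r] by simp
    qed
    ultimately show "?q 0 = 0" using sublinear_zero[OF p] by simp
  qed
  then obtain g where g: "linear g" "g \<le> ?q" by (rule linear_below_sublinear)
  have gp: "g x \<le> p x" for x
    using le_funD[OF g(2), of x] low[of 0 0 x] subspace_0[OF \<Gamma>] by (simp add: zero_prod_def)
  have g\<Gamma>: "g x \<le> r" if "(x, r) \<in> \<Gamma>" for x r
    using le_funD[OF g(2), of x] low[OF that, of x] sublinear_zero[OF p] by simp
  have "g x = r" if "(x, r) \<in> \<Gamma>" for x r
    using g\<Gamma>[OF that] g\<Gamma>[OF neg[OF that]] linear_neg[OF g(1), of x] by simp
  then show ?thesis using that g(1) gp by blast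
qed

section \<open>Extending finite-rank operators into an L-infinity space\<close>

lemma onorm_on_ge:
  "x \<in> G \<Longrightarrow> ereal (norm (T x) / norm x) \<le> onorm_on G T"
  unfolding onorm_on_def by (rule SUP_upper)

lemma onorm_on_bound:
  assumes "onorm_on G T = ereal a" "x \<in> G" "T 0 = 0"
  shows "norm (T x) \<le> a * norm x"
proof (cases "x = 0")
  case False
  have "norm (T x) / norm x \<le> a" using onorm_on_ge[OF assms(2), of T] assms(1) by simp
  then show ?thesis using False by (simp add: field_simps)
qed (simp add: assms)

lemma linear_iso_on_zero:
  assumes "linear_iso_on G H T" "0 \<in> G"
  shows "T 0 = 0"
proof -
  have "T (0 *\<^sub>R 0) = 0 *\<^sub>R T 0" using assms unfolding linear_iso_on_def by blast
  then show ?thesis by simp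
qed

text \<open>
  The maps in the Banach-Mazur distance are linear only on the subspace, so additivity of the inverse
  is derived inside \<open>G\<close>.
\<close>

lemma linear_iso_on_inverse:
  assumes T: "linear_iso_on G H T" and G: "subspace G"
  shows "linear_iso_on H G (inv_into G T)"
proof -
  let ?S = "inv_into G T"
  have b: "bij_betw T G H" and add: "\<And>x y. x \<in> G \<Longrightarrow> y \<in> G \<Longrightarrow> T (x + y) = T x + T y"
    and sc: "\<And>c x. x \<in> G \<Longrightarrow> T (c *\<^sub>R x) = c *\<^sub>R T x"
    using T by (auto simp: linear_iso_on_def)
  have S: "?S h \<in> G" "T (?S h) = h" if "h \<in> H" for h
    using that b by (auto simp: bij_betw_def inv_into_into f_inv_into_f)
  have inv: "?S (T x) = x" if "x \<in> G" for x
    using that b by (simp add: bij_betw_def)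
  have "?S (h + k) = ?S h + ?S k" if "h \<in> H" "k \<in> H" for h k
    using inv[of "?S h + ?S k"] add S that subspace_add[OF G] by metis
  moreover have "?S (c *\<^sub>R h) = c *\<^sub>R ?S h" if "h \<in> H" for c h
    using inv[of "c *\<^sub>R ?S h"] sc S that subspace_scale[OF G] by metis
  ultimately show ?thesis
    using bij_betw_inv_into[OF b] by (auto simp: linear_iso_on_def)
qed

text \<open>
  A product of extended reals below a finite bound does not make the factors finite, since zero times
  infinity is zero; but a factor is zero only for the zero space, which is treated separately.
\<close>

lemma banach_mazur_isomorphism:
  assumes G: "subspace G" and d: "banach_mazur_dist G H < ereal \<mu>"
  obtains T a b where "linear_iso_on G H T" "a \<ge> 0" "b \<ge> 0" "b * a \<le> \<mu>"
    "\<And>x. x \<in> G \<Longrightarrow> norm (T x) \<le> a * norm x"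
    "\<And>h. h \<in> H \<Longrightarrow> norm (inv_into G T h) \<le> b * norm h"
proof -
  obtain T where T: "linear_iso_on G H T"
    and prod: "onorm_on G T * onorm_on H (inv_into G T) < ereal \<mu>"
    using d unfolding banach_mazur_dist_def INF_less_iff by auto
  let ?S = "inv_into G T"
  have T0: "T 0 = 0" using linear_iso_on_zero[OF T] subspace_0[OF G] .
  have bij: "bij_betw T G H" using T by (simp add: linear_iso_on_def)
  have S0: "?S 0 = 0"
    using T0 bij subspace_0[OF G] by (metis bij_betw_def inv_into_f_f)
  have pos: "0 \<le> onorm_on G T" "0 \<le> onorm_on H ?S"
    using onorm_on_ge[of 0 G T] onorm_on_ge[of "T 0" H ?S] subspace_0[OF G] bij T0
    by (auto simp: bij_betw_def zero_ereal_def)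
  show ?thesis
  proof (cases "G = {0}")
    case True
    have "H = {0}" using bij True T0 by (auto simp: bij_betw_def)
    moreover have "0 < \<mu>"
    proof -
      have "0 \<le> onorm_on G T * onorm_on H ?S" using pos by simp
      then show ?thesis using prod by (metis ereal_less(2) le_less_trans)
    qed
    ultimately show ?thesis
      by (intro that[of T 0 0]) (use T True T0 S0 in auto)
  next
    case False
    then obtain x where x: "x \<in> G" "x \<noteq> 0" using subspace_0[OF G] by blast
    have Tx: "T x \<in> H" "T x \<noteq> 0" "?S (T x) = x"
      using bij x T0 subspace_0[OF G] by (auto simp: bij_betw_def inj_on_def)
    have "0 < ereal (norm (T x) / norm x)" "0 < ereal (norm (?S (T x)) / norm (T x))"
      using x Tx by auto
    then have p: "0 < onorm_on G T" "0 < onorm_on H ?S"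
      using onorm_on_ge[OF x(1), of T] onorm_on_ge[OF Tx(1), of ?S] by (metis less_le_trans)+
    then obtain a b where ab: "onorm_on G T = ereal a" "onorm_on H ?S = ereal b"
      using prod by (cases "onorm_on G T"; cases "onorm_on H ?S") auto
    show ?thesis
    proof (rule that[OF T])
      show "0 \<le> a" "0 \<le> b" using p ab by auto
      show "b * a \<le> \<mu>" using prod ab by (simp add: mult.commute)
      show "norm (T x) \<le> a * norm x" if "x \<in> G" for x
        using onorm_on_bound[OF ab(1) that T0] .
      show "norm (?S h) \<le> b * norm h" if "h \<in> H" for h
        using onorm_on_bound[OF ab(2) that S0] .
    qed
  qed
qed

lemma apply_bcontfun_nat:
  fixes f :: "nat \<Rightarrow> real"
  assumes "\<And>i. \<bar>f i\<bar> \<le> c"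
  shows "apply_bcontfun (Bcontfun f) = f"
  by (rule Bcontfun_inverse, rule bcontfun_normI[where b=c]) (use assms in auto)

text \<open>
  Through an isomorphism of \<open>G\<close> with n-dimensional space under the maximum norm, the map with graph
  \<open>\<Gamma>\<close> becomes a family of functionals. Each extends by Hahn-Banach with the same bound, and the
  maximum norm of the family obeys this bound too, so that only the distortion \<open>\<mu>\<close> is lost.
\<close>

lemma extension_into_L_infty_piece:
  fixes \<Gamma> :: "('x::real_vector \<times> 'e::banach) set"
  assumes G: "fin_dim G" and d: "banach_mazur_dist G (ell_infty n) < ereal \<mu>"
    and \<Gamma>: "subspace \<Gamma>" and rG: "\<And>x e. (x, e) \<in> \<Gamma> \<Longrightarrow> e \<in> G"
    and p: "seminorm p" and K: "K \<ge> 0" and bd: "\<And>x e. (x, e) \<in> \<Gamma> \<Longrightarrow> norm e \<le> K * p x"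
  obtains P where "linear P" "range P \<subseteq> G" "\<And>x. norm (P x) \<le> \<mu> * K * p x"
    "\<And>x e. (x, e) \<in> \<Gamma> \<Longrightarrow> P x = e"
proof -
  note sG = fin_dim_imp_subspace[OF G]
  obtain T a b where T: "linear_iso_on G (ell_infty n) T" and ab: "a \<ge> 0" "b \<ge> 0" "b * a \<le> \<mu>"
    and Ta: "\<And>x. x \<in> G \<Longrightarrow> norm (T x) \<le> a * norm x"
    and Sb: "\<And>h. h \<in> ell_infty n \<Longrightarrow> norm (inv_into G T h) \<le> b * norm h"
    using banach_mazur_isomorphism[OF sG d] by blast
  let ?S = "inv_into G T"
  have bij: "bij_betw T G (ell_infty n)"
    and Tadd: "\<And>x y. x \<in> G \<Longrightarrow> y \<in> G \<Longrightarrow> T (x + y) = T x + T y"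
    and Tsc: "\<And>c x. x \<in> G \<Longrightarrow> T (c *\<^sub>R x) = c *\<^sub>R T x"
    using T by (auto simp: linear_iso_on_def)
  have S: "bij_betw ?S (ell_infty n) G"
    and Sadd: "\<And>x y. x \<in> ell_infty n \<Longrightarrow> y \<in> ell_infty n \<Longrightarrow> ?S (x + y) = ?S x + ?S y"
    and Ssc: "\<And>c x. x \<in> ell_infty n \<Longrightarrow> ?S (c *\<^sub>R x) = c *\<^sub>R ?S x"
    using linear_iso_on_inverse[OF T sG] by (auto simp: linear_iso_on_def)
  have aK: "a * K \<ge> 0" using ab K by simp
  have sub: "sublinear (\<lambda>x. a * K * p x)"
  proof -
    have "a * K * p (x + y) \<le> a * K * p x + a * K * p y" for x y
      using mult_left_mono[OF seminorm_add[OF p, of x y] aK] by (simp add: algebra_simps)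
    then show ?thesis using seminorm_scale[OF p] by (auto simp: sublinear_def)
  qed
  have "\<exists>g. linear g \<and> (\<forall>x. g x \<le> a * K * p x) \<and> (\<forall>x e. (x, e) \<in> \<Gamma> \<longrightarrow> g x = T e i)" for i
  proof -
    let ?\<Gamma> = "{(x, r). \<exists>e. (x, e) \<in> \<Gamma> \<and> r = T e i}"
    have "subspace ?\<Gamma>"
    proof (rule subspaceI)
      show "0 \<in> ?\<Gamma>"
        using linear_iso_on_zero[OF T] subspace_0[OF sG] subspace_0[OF \<Gamma>]
        by (force simp: zero_prod_def)
    next
      fix u v assume "u \<in> ?\<Gamma>" "v \<in> ?\<Gamma>"
      then obtain x e y f where uv: "u = (x, T e i)" "(x, e) \<in> \<Gamma>" "v = (y, T f i)" "(y, f) \<in> \<Gamma>"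
        by auto
      then have "(x + y, e + f) \<in> \<Gamma>" using subspace_add[OF \<Gamma>, of "(x, e)" "(y, f)"] by simp
      moreover have "T (e + f) = T e + T f" using uv rG Tadd by blast
      ultimately show "u + v \<in> ?\<Gamma>" using uv by auto
    next
      fix c u assume "u \<in> ?\<Gamma>"
      then obtain x e where u: "u = (x, T e i)" "(x, e) \<in> \<Gamma>" by auto
      then have "(c *\<^sub>R x, c *\<^sub>R e) \<in> \<Gamma>" using subspace_scale[OF \<Gamma>, of "(x, e)" c] by simp
      moreover have "T (c *\<^sub>R e) = c *\<^sub>R T e" using u rG Tsc by blast
      ultimately show "c *\<^sub>R u \<in> ?\<Gamma>" using u by auto
    qed
    moreover have "r \<le> a * K * p x" if xr: "(x, r) \<in> ?\<Gamma>" for x r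
    proof -
      obtain e where e: "(x, e) \<in> \<Gamma>" "r = T e i" using xr by auto
      have "r \<le> norm (T e)" using norm_bounded[of "T e" i] e(2) by simp
      also have "\<dots> \<le> a * norm e" using Ta rG e by blast
      also have "\<dots> \<le> a * (K * p x)" using bd[OF e(1)] ab by (simp add: mult_left_mono)
      finally show ?thesis by simp
    qed
    ultimately obtain g where "linear g" "\<And>x. g x \<le> a * K * p x" "\<And>x r. (x, r) \<in> ?\<Gamma> \<Longrightarrow> g x = r"
      using Hahn_Banach_relation[OF sub, of ?\<Gamma>] by blast
    then show ?thesis by blast
  qed
  then obtain g where g: "\<And>i. linear (g i)" and gp: "\<And>i x. g i x \<le> a * K * p x"
    and g\<Gamma>: "\<And>i x e. (x, e) \<in> \<Gamma> \<Longrightarrow> g i x = T e i"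
    by metis
  have gabs: "\<bar>g i x\<bar> \<le> a * K * p x" for i x
    using gp[of i x] gp[of i "- x"] linear_neg[OF g, of i x] seminorm_minus[OF p, of x] by auto
  have aKp: "0 \<le> a * K * p x" for x using aK seminorm_nonneg[OF p] by simp
  define h where "h x = Bcontfun (\<lambda>i. if i < n then g i x else 0)" for x
  have h: "apply_bcontfun (h x) i = (if i < n then g i x else 0)" for x i
    unfolding h_def
    by (subst apply_bcontfun_nat[where c="a * K * p x"]) (use gabs aKp in auto)
  have hl: "h x \<in> ell_infty n" for x by (auto simp: ell_infty_def h)
  have hadd: "h (x + y) = h x + h y" for x y
    by (rule bcontfun_eqI) (simp add: h plus_bcontfun.rep_eq linear_add[OF g])
  have hsc: "h (c *\<^sub>R x) = c *\<^sub>R h x" for c x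
    by (rule bcontfun_eqI) (simp add: h scaleR_bcontfun.rep_eq linear_scale[OF g])
  have hn: "norm (h x) \<le> a * K * p x" for x
    by (rule norm_bound) (use gabs aKp in \<open>simp add: h\<close>)
  show ?thesis
  proof (rule that[of "\<lambda>x. ?S (h x)"])
    show "linear (\<lambda>x. ?S (h x))"
      by (rule linearI) (simp_all add: hadd hsc hl Sadd Ssc)
    show "range (\<lambda>x. ?S (h x)) \<subseteq> G"
      using S hl by (auto simp: bij_betw_def)
    show "norm (?S (h x)) \<le> \<mu> * K * p x" for x
    proof -
      have "norm (?S (h x)) \<le> b * norm (h x)" using Sb hl by blast
      also have "\<dots> \<le> b * (a * K * p x)" using hn ab by (simp add: mult_left_mono)
      also have "\<dots> = (b * a) * (K * p x)" by simp
      also have "\<dots> \<le> \<mu> * (K * p x)"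
        using ab K seminorm_nonneg[OF p] by (intro mult_right_mono) auto
      finally show ?thesis by simp
    qed
    show "?S (h x) = e" if "(x, e) \<in> \<Gamma>" for x e
    proof -
      have eG: "e \<in> G" using rG that by blast
      then have "T e \<in> ell_infty n" using bij by (auto simp: bij_betw_def)
      then have "h x = T e"
        by (intro bcontfun_eqI) (auto simp: h ell_infty_def g\<Gamma>[OF that])
      then show ?thesis using bij eG by (simp add: bij_betw_def)
    qed
  qed
qed

text \<open>
  The property of \<open>E\<close> that the rest of the proof uses: maps from subspaces of \<open>X\<close> into
  finite-dimensional subspaces of \<open>E\<close>, bounded for a seminorm \<open>p\<close> on \<open>X\<close>, extend to \<open>X\<close> with finite
  rank and at most \<open>M\<close> times the bound. Maps on subspaces are given by their graphs \<open>\<Gamma>\<close>.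
\<close>

definition finite_rank_extension :: "'x::real_vector itself \<Rightarrow> 'e::real_normed_vector itself \<Rightarrow> real \<Rightarrow> bool" where
  "finite_rank_extension X E M \<longleftrightarrow> M \<ge> 0 \<and>
    (\<forall>(B::'e set) (\<Gamma>::('x \<times> 'e) set) p K. fin_dim B \<longrightarrow> subspace \<Gamma> \<longrightarrow> snd ` \<Gamma> \<subseteq> B \<longrightarrow>
       seminorm p \<longrightarrow> K \<ge> 0 \<longrightarrow> (\<forall>x e. (x, e) \<in> \<Gamma> \<longrightarrow> norm e \<le> K * p x) \<longrightarrow>
       (\<exists>P. linear P \<and> fin_dim (range P) \<and> (\<forall>x. norm (P x) \<le> M * K * p x) \<and>
          (\<forall>x e. (x, e) \<in> \<Gamma> \<longrightarrow> P x = e)))"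

text \<open>
  The Banach-Mazur distance is an infimum that need not be attained, whence \<open>\<mu> + 1\<close> for the constant.
\<close>

lemma L_infty_space_extension:
  assumes "L_infty_space TYPE('e::banach)"
  obtains M where "finite_rank_extension TYPE('x::real_vector) TYPE('e) M"
proof -
  obtain \<mu> where \<mu>: "\<mu> \<ge> 1" and G: "\<And>F::'e set. fin_dim F \<Longrightarrow>
      \<exists>G. fin_dim G \<and> F \<subseteq> G \<and> banach_mazur_dist G (ell_infty (dim G)) \<le> ereal \<mu>"
    using assms unfolding L_infty_space_def by blast
  have "\<exists>P. linear P \<and> fin_dim (range P) \<and> (\<forall>x. norm (P x) \<le> (\<mu> + 1) * K * p x) \<and>
          (\<forall>x e. (x, e) \<in> \<Gamma> \<longrightarrow> P x = e)"
    if "fin_dim B" "subspace \<Gamma>" "snd ` \<Gamma> \<subseteq> B" "seminorm p" "K \<ge> 0" "\<forall>x e. (x, e) \<in> \<Gamma> \<longrightarrow> norm e \<le> K * p x"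
    for B :: "'e set" and \<Gamma> :: "('x \<times> 'e) set" and p K
  proof -
    note hyps = that
    obtain G where G: "fin_dim G" "B \<subseteq> G" "banach_mazur_dist G (ell_infty (dim G)) \<le> ereal \<mu>"
      using G[OF hyps(1)] by blast
    have "banach_mazur_dist G (ell_infty (dim G)) < ereal (\<mu> + 1)"
      using G(3) by (rule le_less_trans) simp
    then obtain P where P: "linear P" "range P \<subseteq> G" "\<And>x. norm (P x) \<le> (\<mu> + 1) * K * p x"
      "\<And>x e. (x, e) \<in> \<Gamma> \<Longrightarrow> P x = e"
      by (rule extension_into_L_infty_piece[OF G(1) _ hyps(2) _ hyps(4,5)]) (use hyps G in force)+
    have "fin_dim (range P)"
      using fin_dim_subset[OF G(1) _ P(2)] linear_subspace_image[OF P(1) subspace_UNIV] by blast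
    with P(1,3,4) show ?thesis by blast
  qed
  then have "finite_rank_extension TYPE('x) TYPE('e) (\<mu> + 1)"
    using \<mu> unfolding finite_rank_extension_def by simp
  then show ?thesis using that by blast
qed

lemma finite_rank_extensionD:
  fixes \<Gamma> :: "('x::real_vector \<times> 'e::real_normed_vector) set"
  assumes "finite_rank_extension TYPE('x) TYPE('e) M" "fin_dim B" "subspace \<Gamma>" "snd ` \<Gamma> \<subseteq> B"
    and "seminorm p" "K \<ge> 0" "\<And>x e. (x, e) \<in> \<Gamma> \<Longrightarrow> norm e \<le> K * p x"
  shows "\<exists>P. linear P \<and> fin_dim (range P) \<and> (\<forall>x. norm (P x) \<le> M * K * p x) \<and>
    (\<forall>x e. (x, e) \<in> \<Gamma> \<longrightarrow> P x = e)"
  using assms unfolding finite_rank_extension_def by simp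

section \<open>Quotients and embeddings with closed range are open onto their range\<close>

text \<open>
  By Baire's theorem in the complete space \<open>range f\<close>, the closure of the image of some ball contains a
  relatively open set. Differences of elements of this closure fill a neighbourhood of zero, so all
  vectors in the range are, after scaling, approximated up to half of their norm.
\<close>

lemma open_mapping_approximate:
  fixes f :: "'a::banach \<Rightarrow> 'b::banach"
  assumes f: "bounded_linear f" and cl: "closed (range f)"
  obtains M where "M > 0"
    "\<And>y. y \<in> range f \<Longrightarrow> \<exists>x. norm x \<le> M * norm y \<and> norm (y - f x) \<le> norm y / 2"
proof -
  interpret f: bounded_linear f by (rule f)
  let ?S = "range f" and ?C = "\<lambda>n::nat. closure (f ` cball 0 (real n))"
  have sub: "subspace ?S" by (rule linear_subspace_image[OF f.linear subspace_UNIV])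
  have CS: "?C n \<subseteq> ?S" for n using cl by (intro closure_minimal) auto
  have cover: "\<Union>(range ?C) = ?S"
  proof
    show "?S \<subseteq> \<Union>(range ?C)"
    proof
      fix y assume "y \<in> ?S"
      then obtain x where x: "y = f x" by blast
      obtain n :: nat where "norm x \<le> real n" using real_arch_simple by blast
      then have "y \<in> f ` cball 0 (real n)" using x by auto
      then show "y \<in> \<Union>(range ?C)" using closure_subset[of "f ` cball 0 (real n)"] by blast
    qed
  qed (use CS in blast)
  have "\<exists>n. top_of_set ?S interior_of (?C n) \<noteq> {}"
  proof (rule ccontr)
    assume neg: "\<not> ?thesis"
    have "top_of_set ?S interior_of \<Union>(range ?C) = {}"
    proof (rule Baire_category_alt)
      show "completely_metrizable_space (top_of_set ?S)
          \<or> locally_compact_space (top_of_set ?S) \<and> regular_space (top_of_set ?S)"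
        using completely_metrizable_space_closedin[OF completely_metrizable_space_euclidean] cl
        by auto
      show "closedin (top_of_set ?S) T \<and> top_of_set ?S interior_of T = {}" if "T \<in> range ?C" for T
        using that neg closed_subset[OF CS closed_closure] by blast
    qed simp
    then show False using cover interior_of_topspace[of "top_of_set ?S"] by simp
  qed
  then obtain n y0 where "y0 \<in> top_of_set ?S interior_of (?C n)" by blast
  then obtain U where U: "openin (top_of_set ?S) U" "y0 \<in> U" "U \<subseteq> ?C n"
    by (auto simp: interior_of_def)
  then obtain r where r: "r > 0" "ball y0 r \<inter> ?S \<subseteq> U" and y0: "y0 \<in> ?S"
    unfolding openin_contains_ball by blast
  have approx: "\<exists>x. norm x \<le> 2 * real n \<and> norm (y - f x) \<le> e"
    if y: "y \<in> ?S" "norm y < r" and e: "e > 0" for y e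
  proof -
    have yy: "y0 + y \<in> ?S" using subspace_add[OF sub y0 y(1)] .
    have "y0 + y \<in> ball y0 r \<inter> ?S" using y yy by (simp add: dist_norm)
    then have "y0 + y \<in> ?C n" using r(2) U(3) by blast
    moreover have "y0 \<in> ?C n" using U(2,3) by blast
    ultimately have "\<exists>v\<in>f ` cball 0 (real n). dist v (y0 + y) < e / 2"
      "\<exists>v\<in>f ` cball 0 (real n). dist v y0 < e / 2"
      using half_gt_zero[OF e] unfolding closure_approachable by blast+
    then obtain a b where ab: "a \<in> cball 0 (real n)" "b \<in> cball 0 (real n)"
      "dist (f a) (y0 + y) < e / 2" "dist (f b) y0 < e / 2"
      by auto
    have "norm (y - f (a - b)) = norm ((f b - y0) - (f a - (y0 + y)))"
      by (simp add: f.diff algebra_simps)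
    also have "\<dots> \<le> norm (f b - y0) + norm (f a - (y0 + y))" by (rule norm_triangle_ineq4)
    also have "\<dots> \<le> e" using ab by (simp add: dist_norm)
    finally have "norm (y - f (a - b)) \<le> e" .
    moreover have "norm (a - b) \<le> 2 * real n"
      using norm_triangle_ineq4[of a b] ab by simp
    ultimately show ?thesis by blast
  qed
  let ?M = "4 * (real n + 1) / r"
  show ?thesis
  proof (rule that)
    show "?M > 0" using r by simp
    fix y assume y: "y \<in> ?S"
    show "\<exists>x. norm x \<le> ?M * norm y \<and> norm (y - f x) \<le> norm y / 2"
    proof (cases "y = 0")
      case True
      then show ?thesis by (intro exI[of _ 0]) (simp add: f.zero)
    next
      case False
      \<comment> \<open>scale \<open>y\<close> into the ball of radius \<open>r\<close>, at norm \<open>r / 2\<close>\<close>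
      define t where "t = r / (2 * norm y)"
      have t: "t > 0" using r False by (simp add: t_def)
      have "t *\<^sub>R y \<in> ?S" using subspace_scale[OF sub y] .
      moreover have "norm (t *\<^sub>R y) < r" using t r False by (simp add: t_def)
      moreover have "r / 4 > 0" using r by simp
      ultimately obtain x where x: "norm x \<le> 2 * real n" "norm (t *\<^sub>R y - f x) \<le> r / 4"
        using approx by blast
      have "norm (y - f ((1/t) *\<^sub>R x)) = norm ((1/t) *\<^sub>R (t *\<^sub>R y - f x))"
        using t by (simp add: f.scaleR algebra_simps)
      also have "\<dots> = norm (t *\<^sub>R y - f x) / t" using t by simp
      also have "\<dots> \<le> (r / 4) / t" using x(2) t by (intro divide_right_mono) linarith+
      also have "\<dots> = norm y / 2" using r False by (simp add: t_def)
      finally have 1: "norm (y - f ((1/t) *\<^sub>R x)) \<le> norm y / 2" .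
      have "norm ((1/t) *\<^sub>R x) = norm x / t" using t by simp
      also have "\<dots> \<le> 2 * (real n + 1) / t" using x t by (intro divide_right_mono) auto
      also have "\<dots> = ?M * norm y" using r False by (simp add: t_def field_simps)
      finally show ?thesis using 1 by blast
    qed
  qed
qed

text \<open>
  Approximating the remaining error again and again gives a geometric series of preimages.

  The form with a closed range serves both for quotient maps and for embeddings.
\<close>

lemma open_mapping_closed_range:
  fixes f :: "'a::banach \<Rightarrow> 'b::banach"
  assumes f: "bounded_linear f" and cl: "closed (range f)"
  obtains K where "K > 0" "\<And>y. y \<in> range f \<Longrightarrow> \<exists>x. f x = y \<and> norm x \<le> K * norm y"
proof -
  interpret f: bounded_linear f by (rule f)
  obtain M where M: "M > 0"
    and ap: "\<And>y. y \<in> range f \<Longrightarrow> \<exists>x. norm x \<le> M * norm y \<and> norm (y - f x) \<le> norm y / 2"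
    using open_mapping_approximate[OF f cl] by blast
  then obtain g where g: "\<And>y. y \<in> range f \<Longrightarrow> norm (g y) \<le> M * norm y"
    and fg: "\<And>y. y \<in> range f \<Longrightarrow> norm (y - f (g y)) \<le> norm y / 2"
    by metis
  show ?thesis
  proof (rule that)
    show "2 * M > 0" using M by simp
    fix y assume y: "y \<in> range f"
    have sub: "subspace (range f)" by (rule linear_subspace_image[OF f.linear subspace_UNIV])
    \<comment> \<open>the error left after \<open>k\<close> approximations\<close>
    define u where "u k = ((\<lambda>v. v - f (g v)) ^^ k) y" for k
    have u0: "u 0 = y" and uS: "u (Suc k) = u k - f (g (u k))" for k
      by (simp_all add: u_def)
    have ur: "u k \<in> range f" for k
    proof (induction k)
      case (Suc k)
      then show ?case unfolding uS by (intro subspace_diff[OF sub]) auto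
    qed (simp add: u0 y)
    have un: "norm (u k) \<le> norm y * (1/2) ^ k" for k
    proof (induction k)
      case (Suc k)
      then show ?case using fg[OF ur[of k]] by (simp add: uS)
    qed (simp add: u0)
    have gn: "norm (g (u k)) \<le> M * norm y * (1/2) ^ k" for k
      using order_trans[OF g[OF ur] mult_left_mono[OF un]] M by (simp add: mult.assoc)
    have geo: "(\<lambda>k. M * norm y * (1/2) ^ k) sums (M * norm y * 2)"
      using sums_mult[OF geometric_sums[of "1/2::real"], of "M * norm y"] by simp
    have sg: "summable (\<lambda>k. norm (g (u k)))"
      by (rule summable_comparison_test'[OF sums_summable[OF geo], of 0]) (use gn in auto)
    then have sg': "summable (\<lambda>k. g (u k))" by (rule summable_norm_cancel)
    have "norm (\<Sum>k. g (u k)) \<le> (\<Sum>k. norm (g (u k)))" by (rule summable_norm[OF sg])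
    also have "\<dots> \<le> M * norm y * 2"
      using suminf_le[OF gn sg sums_summable[OF geo]] sums_unique[OF geo] by simp
    finally have n: "norm (\<Sum>k. g (u k)) \<le> 2 * M * norm y" by (simp add: mult.commute mult.left_commute)
    have "(\<lambda>k. norm y * (1/2) ^ k) \<longlonglongrightarrow> norm y * 0"
      by (intro tendsto_mult_left LIMSEQ_power_zero) simp
    then have "u \<longlonglongrightarrow> 0"
      using un by (intro Lim_null_comparison[of u "\<lambda>k. norm y * (1/2) ^ k"]) auto
    \<comment> \<open>the images of the approximations are successive differences of the errors\<close>
    then have "(\<lambda>k. u k - u (Suc k)) sums (u 0 - 0)" by (rule telescope_sums')
    then have "(\<lambda>k. f (g (u k))) sums y" by (simp add: uS u0)
    moreover have "(\<lambda>k. f (g (u k))) sums f (\<Sum>k. g (u k))"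
      using f.sums[OF summable_sums[OF sg']] .
    ultimately have "f (\<Sum>k. g (u k)) = y" using sums_unique2 by blast
    then show "\<exists>x. f x = y \<and> norm x \<le> 2 * M * norm y" using n by blast
  qed
qed

section \<open>Limits of uniformly bounded operators with a common finite-dimensional range\<close>

text \<open>
  The linear operators into \<open>W\<close> with the pointwise bound \<open>p\<close> form a closed subset of a product of
  compact balls of \<open>W\<close>, and prescribing a value is a closed condition, so the finite
  intersection property applies.
\<close>

lemma bounded_operators_finite_intersection:
  fixes W :: "'z::real_normed_vector set" and \<Phi> :: "('x::real_vector \<times> 'z) set" and p :: "'x \<Rightarrow> real"
  assumes W: "fin_dim W"
    and fin: "\<And>\<Psi>. finite \<Psi> \<Longrightarrow> \<Psi> \<subseteq> \<Phi> \<Longrightarrow>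
      \<exists>R. linear R \<and> (\<forall>x. R x \<in> W \<and> norm (R x) \<le> p x) \<and> (\<forall>(x, z)\<in>\<Psi>. R x = z)"
  shows "\<exists>R. linear R \<and> (\<forall>x. R x \<in> W \<and> norm (R x) \<le> p x) \<and> (\<forall>(x, z)\<in>\<Phi>. R x = z)"
proof -
  let ?P = "PiE UNIV (\<lambda>x. W \<inter> cball 0 (p x))"
  let ?L = "{R :: 'x \<Rightarrow> 'z. linear R}"
  have ev: "continuous_on UNIV (\<lambda>R :: 'x \<Rightarrow> 'z. R x)" for x
    by (rule continuous_on_product_coordinates)
  have "compactin (product_topology (\<lambda>x. euclidean) UNIV) ?P"
    using fin_dim_compact_Int_cball[OF W] by (subst compactin_PiE) auto
  then have cP: "compact ?P" by (simp add: euclidean_product_topology)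
  have "?L = {R. (\<forall>x y. R (x + y) = R x + R y) \<and> (\<forall>c x. R (c *\<^sub>R x) = c *\<^sub>R R x)}"
    by (auto simp: linear_iff)
  moreover have "closed \<dots>"
    by (intro closed_Collect_conj closed_Collect_all closed_Collect_eq continuous_intros ev)
  ultimately have "closed ?L" by simp
  then have c: "compact (?P \<inter> ?L)" using cP compact_Int_closed by blast
  have "(?P \<inter> ?L) \<inter> (\<Inter>(x, z)\<in>\<Phi>. {R. R x = z}) \<noteq> {}"
  proof (rule compact_imp_fip_image[OF c])
    fix i assume "i \<in> \<Phi>"
    show "closed (case i of (x, z) \<Rightarrow> {R :: 'x \<Rightarrow> 'z. R x = z})"
      by (cases i) (auto intro!: closed_Collect_eq ev continuous_intros)
  next
    fix \<Psi> assume "finite \<Psi>" "\<Psi> \<subseteq> \<Phi>"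
    then obtain R where "linear R" "\<And>x. R x \<in> W \<and> norm (R x) \<le> p x" "\<forall>(x, z)\<in>\<Psi>. R x = z"
      using fin by blast
    then have "R \<in> (?P \<inter> ?L) \<inter> (\<Inter>(x, z)\<in>\<Psi>. {R. R x = z})" by (auto simp: PiE_UNIV_domain)
    then show "(?P \<inter> ?L) \<inter> (\<Inter>(x, z)\<in>\<Psi>. {R. R x = z}) \<noteq> {}" by blast
  qed
  then obtain R where "R \<in> ?P" "linear R" "\<forall>(x, z)\<in>\<Phi>. R x = z" by fastforce
  then show ?thesis by (intro exI[of _ R]) (auto simp: PiE_UNIV_domain Pi_iff)
qed

section \<open>The approximation property in extensions by an L-infinity space\<close>

text \<open>
  The bounded approximation property of the normed space obtained from \<open>p\<close> by identifying points at
  distance zero.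
\<close>

definition seminorm_BAP :: "('x::real_vector \<Rightarrow> real) \<Rightarrow> bool" where
  "seminorm_BAP p \<longleftrightarrow> (\<exists>L\<ge>0. \<forall>F. fin_dim F \<longrightarrow>
     (\<exists>T. linear T \<and> fin_dim (range T) \<and> (\<forall>x. p (T x) \<le> L * p x) \<and> (\<forall>f\<in>F. p (T f - f) = 0)))"

text \<open>
  An exact sequence \<open>0 \<rightarrow> E \<rightarrow> X \<rightarrow> Z \<rightarrow> 0\<close> whose middle is only seminormed. The first bound makes \<open>i\<close> an embedding, and \<open>lift\<close> is the openness of \<open>q\<close>. Elements of
  the kernel of \<open>q\<close> belong to \<open>E\<close> up to a vector of seminorm zero.
\<close>

locale seminormed_extension =
  fixes p :: "'x::real_vector \<Rightarrow> real" and i :: "'e::banach \<Rightarrow> 'x" and q :: "'x \<Rightarrow> 'z::banach"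
    and K :: real
  assumes p: "seminorm p" and i: "linear i" and q: "linear q" and K: "K > 0"
    and embed: "norm e \<le> K * p (i e)" and i_bound: "p (i e) \<le> K * norm e"
    and q_bound: "norm (q x) \<le> K * p x" and q_i: "q (i e) = 0"
    and kernel: "q x = 0 \<Longrightarrow> \<exists>e. p (x - i e) = 0"
    and lift: "\<exists>x. q x = z \<and> p x \<le> K * norm z"
begin

lemma p_nonneg: "0 \<le> p x"
  by (rule seminorm_nonneg[OF p])

lemma local_projection:
  assumes M: "finite_rank_extension TYPE('x) TYPE('e) M" and B: "fin_dim B"
  obtains P where "linear P" "fin_dim (range P)" "\<And>x. norm (P x) \<le> M * K * p x"
    "\<And>e. e \<in> B \<Longrightarrow> P (i e) = e"
proof -
  let ?\<Gamma> = "(\<lambda>e. (i e, e)) ` B"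
  have "linear (\<lambda>e. (i e, e))"
    by (rule linearI) (simp_all add: linear_add[OF i] linear_scale[OF i])
  then have 1: "subspace ?\<Gamma>" using fin_dim_imp_subspace[OF B] by (rule linear_subspace_image)
  have 2: "snd ` ?\<Gamma> \<subseteq> B" by auto
  have 3: "norm e \<le> K * p x" if "(x, e) \<in> ?\<Gamma>" for x e using that embed by auto
  obtain P where "linear P" "fin_dim (range P)" "\<And>x. norm (P x) \<le> M * K * p x"
    "\<And>x e. (x, e) \<in> ?\<Gamma> \<Longrightarrow> P x = e"
    using finite_rank_extensionD[OF M B 1 2 p less_imp_le[OF K] 3] by blast
  then show ?thesis using that by blast
qed

lemma remainder_bound:
  assumes "linear P" "\<And>x. norm (P x) \<le> C * p x"
  shows "p (x - i (P x)) \<le> (1 + K * C) * p x"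
proof -
  have "p (x - i (P x)) \<le> p x + p (i (P x))" by (rule seminorm_diff[OF p])
  also have "p (i (P x)) \<le> K * norm (P x)" by (rule i_bound)
  also have "K * norm (P x) \<le> K * (C * p x)" using assms(2) K by (simp add: mult_left_mono)
  finally show ?thesis by (simp add: algebra_simps)
qed

text \<open>
  Let \<open>s0\<close> be any linear lifting on \<open>W\<close>. For the points \<open>n\<close> of a finite net in the unit ball, let \<open>l n\<close> be
  lifts of controlled size; then \<open>s0 n - l n\<close> lies in \<open>E\<close>. If \<open>P\<close> fixes these vectors and \<open>c = 1 - P\<close>,
  then \<open>c (s0 n) = c (l n)\<close> is of controlled size, so the lifting \<open>c s0\<close> is bounded on the net. A
  net of mesh 1/2 then bounds it on the unit ball, with twice the constant.
\<close>

lemma uniform_lifting: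
  assumes M: "finite_rank_extension TYPE('x) TYPE('e) M" and W: "fin_dim W"
  obtains s where "linear s" "\<And>w. w \<in> W \<Longrightarrow> q (s w) = w"
    "\<And>w. w \<in> W \<Longrightarrow> p (s w) \<le> 2 * (1 + K * (M * K)) * K * norm w"
proof -
  obtain B where B: "finite B" "independent B" "W = span B" using fin_dim_basis[OF W] .
  note sW = fin_dim_imp_subspace[OF W]
  obtain l where l: "\<And>z. q (l z) = z" "\<And>z. p (l z) \<le> K * norm z" using lift by metis
  obtain s0 where s0: "linear s0" "\<forall>x\<in>B. s0 x = l x" using linear_independent_extend[OF B(2)] by blast
  have qs0: "q (s0 w) = w" if "w \<in> W" for w
  proof -
    have "(q \<circ> s0) w = id w"
      by (rule linear_eq_on_span[OF linear_compose[OF s0(1) q] linear_id])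
        (use s0 l that B in auto)
    then show ?thesis by simp
  qed
  obtain N where N: "finite N" "N \<subseteq> W \<inter> cball 0 1" "W \<inter> cball 0 1 \<subseteq> (\<Union>n\<in>N. ball n (1/2))"
    by (rule compactE_image[OF fin_dim_compact_Int_cball[OF W, of 1], of "W \<inter> cball 0 1" "\<lambda>n. ball n (1/2)"])
      auto
  have "\<exists>e. p (s0 n - l n - i e) = 0" if "n \<in> N" for n
    by (rule kernel) (use that N qs0 l linear_diff[OF q] in auto)
  then obtain e where e: "\<And>n. n \<in> N \<Longrightarrow> p (s0 n - l n - i (e n)) = 0" by metis
  obtain P where P: "linear P" "\<And>x. norm (P x) \<le> M * K * p x"
    and Pe: "\<And>y. y \<in> span (e ` N) \<Longrightarrow> P (i y) = y"
    using local_projection[OF M fin_dim_span[of "e ` N"]] N(1) by blast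
  let ?D = "1 + K * (M * K)"
  define c where "c x = x - i (P x)" for x
  have c: "linear c" unfolding c_def
    by (intro linear_compose_sub linear_id[unfolded id_def] linear_compose[OF P(1) i, unfolded o_def])
  have cb: "p (c x) \<le> ?D * p x" for x
    unfolding c_def by (rule remainder_bound[OF P])
  have D: "?D \<ge> 0" using M K by (simp add: finite_rank_extension_def)
  define s where "s w = c (s0 w)" for w
  have s: "linear s" unfolding s_def by (rule linear_compose[OF s0(1) c, unfolded o_def])
  have qs: "q (s w) = w" if "w \<in> W" for w
    using qs0[OF that] by (simp add: s_def c_def linear_diff[OF q] q_i)
  have sN: "p (s n) \<le> ?D * K" if n: "n \<in> N" for n
  proof -
    have ci: "c (i (e n)) = 0" using Pe n by (simp add: c_def span_base)
    have "s n = c (s0 n - l n - i (e n)) + c (l n)"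
      using ci by (simp add: s_def linear_diff[OF c])
    then have "p (s n) \<le> p (c (s0 n - l n - i (e n))) + p (c (l n))"
      using seminorm_add[OF p] by simp
    also have "\<dots> \<le> ?D * 0 + ?D * p (l n)" using cb[of "s0 n - l n - i (e n)"] cb[of "l n"] e[OF n] by simp
    also have "p (l n) \<le> K * 1" using N(2) n l(2)[of n] K
      by (metis IntD2 mem_cball_0 mult_left_mono less_imp_le order_trans subsetD)
    finally show ?thesis using D by (simp add: mult_left_mono)
  qed
  obtain C where C: "C \<ge> 0" "\<And>w. w \<in> W \<Longrightarrow> p (s w) \<le> C * norm w"
    using linear_bounded_on_fin_dim[OF W s p] by blast
  let ?U = "W \<inter> cball 0 1" and ?S = "SUP w\<in>W \<inter> cball 0 1. p (s w)"
  have bdd: "bdd_above ((\<lambda>w. p (s w)) ` ?U)"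
  proof (rule bdd_aboveI2)
    fix w assume w: "w \<in> ?U"
    then have "p (s w) \<le> C * norm w" using C by blast
    also have "\<dots> \<le> C * 1" using w C by (intro mult_left_mono) auto
    finally show "p (s w) \<le> C" by simp
  qed
  have up: "p (s w) \<le> ?S" if "w \<in> ?U" for w using cSUP_upper[OF that bdd] .
  \<comment> \<open>a vector \<open>w\<close> of the unit ball is a net point plus half of another vector of the unit ball\<close>
  have "?S \<le> ?D * K + ?S / 2"
  proof (rule cSUP_least)
    have "0 \<in> ?U" using subspace_0[OF sW] by simp
    then show "?U \<noteq> {}" by blast
    fix w assume w: "w \<in> ?U"
    then obtain n where n: "n \<in> N" "w \<in> ball n (1/2)" using N(3) by blast
    have "w - n \<in> W" using w n N(2) subspace_diff[OF sW] by blast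
    then have "2 *\<^sub>R (w - n) \<in> ?U"
      using n subspace_scale[OF sW] by (auto simp: dist_norm norm_minus_commute)
    then have "p (s (2 *\<^sub>R (w - n))) \<le> ?S" by (rule up)
    then have h: "p (s (w - n)) \<le> ?S / 2"
      by (simp only: linear_scale[OF s] seminorm_scale[OF p])
    have "s w = s n + s (w - n)" by (simp add: linear_diff[OF s])
    then have "p (s w) \<le> p (s n) + p (s (w - n))" using seminorm_add[OF p] by metis
    then show "p (s w) \<le> ?D * K + ?S / 2" using sN[OF n(1)] h by simp
  qed
  then have S: "?S \<le> 2 * ?D * K" by argo
  have "p (s w) \<le> 2 * ?D * K * norm w" if w: "w \<in> W" for w
  proof (cases "w = 0")
    case True
    then show ?thesis by (simp add: linear_0[OF s] seminorm_zero[OF p])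
  next
    case False
    have "(1 / norm w) *\<^sub>R w \<in> ?U" using w False subspace_scale[OF sW] by simp
    then have "p (s ((1 / norm w) *\<^sub>R w)) \<le> 2 * ?D * K" using up S by (meson order_trans)
    then show ?thesis using False
      by (simp only: linear_scale[OF s] seminorm_scale[OF p]) (simp add: field_simps)
  qed
  then show ?thesis using that s qs by blast
qed

text \<open>
  The operators \<open>u (1 - P)\<close> with \<open>u = q T\<close> have their values in \<open>range u\<close>, send \<open>s f\<close> to \<open>f\<close> and vanish on
  any prescribed finite set of vectors of \<open>E\<close>. A simultaneous solution of all these conditions vanishes
  on the kernel of \<open>q\<close>, so it induces an operator on \<open>Z\<close>.
\<close>

lemma BAP_quotient:
  assumes M: "finite_rank_extension TYPE('x) TYPE('e) M" and "seminorm_BAP p"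
  shows "BAP TYPE('z)"
proof -
  obtain L where L: "L \<ge> 0" and T: "\<And>F. fin_dim F \<Longrightarrow>
     \<exists>T. linear T \<and> fin_dim (range T) \<and> (\<forall>x. p (T x) \<le> L * p x) \<and> (\<forall>f\<in>F. p (T f - f) = 0)"
    using assms(2) unfolding seminorm_BAP_def by blast
  have M0: "M \<ge> 0" using M by (simp add: finite_rank_extension_def)
  \<comment> \<open>bounds for \<open>s\<close>, for the map \<open>i e + s f \<mapsto> e\<close>, and for \<open>u (1 - P)\<close>\<close>
  define S where "S = 2 * (1 + K * (M * K)) * K"
  define K' where "K' = K * (1 + S * K)"
  define C where "C = K * L * (1 + K * (M * K'))"
  have pos: "S \<ge> 0" "K' \<ge> 0" "C \<ge> 0" using K M0 L by (simp_all add: S_def K'_def C_def)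
  have "\<exists>R. bounded_linear R \<and> fin_dim (range R) \<and> onorm R \<le> C * K \<and> (\<forall>f\<in>F. R f = f)"
    if F: "fin_dim F" for F :: "'z set"
  proof -
    note sF = fin_dim_imp_subspace[OF F]
    obtain s where s: "linear s" and qs: "\<And>w. w \<in> F \<Longrightarrow> q (s w) = w"
      and ps: "\<And>w. w \<in> F \<Longrightarrow> p (s w) \<le> S * norm w"
      using uniform_lifting[OF M F] unfolding S_def by blast
    obtain T where T: "linear T" "fin_dim (range T)" "\<And>x. p (T x) \<le> L * p x"
      "\<And>x. x \<in> s ` F \<Longrightarrow> p (T x - x) = 0"
      using T[OF fin_dim_linear_image[OF s F]] by blast
    define u where "u x = q (T x)" for x
    have u: "linear u" unfolding u_def by (rule linear_compose[OF T(1) q, unfolded o_def])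
    have "range u = q ` range T" by (auto simp: u_def)
    then have W: "fin_dim (range u)" using fin_dim_linear_image[OF q T(2)] by simp
    have ub: "norm (u x) \<le> K * L * p x" for x
      using order_trans[OF q_bound mult_left_mono[OF T(3)]] K by (simp add: u_def mult.assoc)
    have us: "u (s f) = f" if f: "f \<in> F" for f
    proof -
      have "norm (q (T (s f) - s f)) \<le> K * 0" using q_bound T(4) f by (metis imageI)
      then show ?thesis using qs[OF f] by (simp add: u_def linear_diff[OF q])
    qed
    let ?\<Phi> = "{(i e, 0) |e. True} \<union> {(s f, f) |f. f \<in> F}"
    have "\<exists>R. linear R \<and> (\<forall>x. R x \<in> range u \<and> norm (R x) \<le> C * p x) \<and> (\<forall>(x, z)\<in>\<Psi>. R x = z)"
      if \<Psi>: "finite \<Psi>" "\<Psi> \<subseteq> ?\<Phi>" for \<Psi>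
    proof -
      \<comment> \<open>the finitely many vectors of \<open>E\<close> at which \<open>\<Psi>\<close> requires a zero\<close>
      let ?A = "{e. (i e, 0) \<in> \<Psi>}"
      have "inj (\<lambda>e. (i e, 0::'z))"
      proof (rule injI)
        fix a b assume "(i a, 0::'z) = (i b, 0)"
        then have "i (a - b) = 0" by (simp add: linear_diff[OF i])
        then have "norm (a - b) \<le> 0" using embed[of "a - b"] seminorm_zero[OF p] by simp
        then show "a = b" by simp
      qed
      then have "finite ?A"
        using finite_vimageI[OF \<Psi>(1), of "\<lambda>e. (i e, 0)"] by (simp add: vimage_def)
      then have B: "fin_dim (span ?A)" by (rule fin_dim_span)
      \<comment> \<open>the graph of the projection of \<open>B + s F\<close> onto \<open>B\<close> along \<open>s F\<close>\<close>
      let ?\<Gamma> = "(\<lambda>(e, f). (i e + s f, e)) ` (span ?A \<times> F)"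
      have "linear (\<lambda>(e, f). (i e + s f, e))"
        by (rule linearI)
          (auto simp: linear_add[OF i] linear_add[OF s] linear_scale[OF i] linear_scale[OF s]
            scaleR_add_right)
      then have 1: "subspace ?\<Gamma>"
        by (rule linear_subspace_image) (intro subspace_Times subspace_span sF)
      have 2: "snd ` ?\<Gamma> \<subseteq> span ?A" by auto
      have 3: "norm e \<le> K' * p x" if xe: "(x, e) \<in> ?\<Gamma>" for x e
      proof -
        obtain f where f: "f \<in> F" "x = i e + s f" using xe by auto
        let ?x = "i e + s f"
        have "q ?x = f" using qs[OF f(1)] by (simp add: linear_add[OF q] q_i)
        then have "p (s f) \<le> S * norm (q ?x)" using ps[OF f(1)] by simp
        also have "\<dots> \<le> S * (K * p ?x)" by (rule mult_left_mono[OF q_bound pos(1)])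
        finally have "p (s f) \<le> S * (K * p ?x)" .
        moreover have "p (i e) \<le> p ?x + p (s f)" using seminorm_diff[OF p, of ?x "s f"] by simp
        ultimately have "p (i e) \<le> (1 + S * K) * p ?x" by (simp add: algebra_simps)
        then have "K * p (i e) \<le> K * ((1 + S * K) * p ?x)" using K by (simp add: mult_left_mono)
        then show ?thesis using embed[of e] f(2) by (simp add: K'_def mult.assoc)
      qed
      obtain P where P: "linear P" "fin_dim (range P)" "\<And>x. norm (P x) \<le> M * K' * p x"
        "\<And>x e. (x, e) \<in> ?\<Gamma> \<Longrightarrow> P x = e"
        using finite_rank_extensionD[OF M B 1 2 p pos(2) 3] by blast
      let ?R = "\<lambda>x. u (x - i (P x))"
      have "linear (\<lambda>x. x - i (P x))"
        by (intro linear_compose_sub linear_id[unfolded id_def] linear_compose[OF P(1) i, unfolded o_def])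
      from linear_compose[OF this u] have "linear ?R" by (simp add: o_def)
      moreover have "norm (?R x) \<le> C * p x" for x
      proof -
        have "norm (?R x) \<le> K * L * p (x - i (P x))" by (rule ub)
        also have "\<dots> \<le> K * L * ((1 + K * (M * K')) * p x)"
          using remainder_bound[OF P(1), of "M * K'" x] P(3) K L by (intro mult_left_mono) auto
        finally show ?thesis by (simp add: C_def mult.assoc)
      qed
      moreover have "?R x = z" if xz: "(x, z) \<in> \<Psi>" for x z
      proof -
        consider e where "x = i e" "z = 0" | f where "x = s f" "z = f" "f \<in> F"
          using \<Psi>(2) xz by blast
        then show ?thesis
        proof cases
          case 1
          then have "e \<in> span ?A" using xz by (auto intro: span_base)
          then have "(i e + s 0, e) \<in> ?\<Gamma>" using subspace_0[OF sF] by force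
          from P(4)[OF this] have "P x = e" using 1 by (simp add: linear_0[OF s])
          then show ?thesis using 1 by (simp add: linear_0[OF u])
        next
          case 2
          have "(i 0 + s f, 0) \<in> ?\<Gamma>" using 2 span_zero[of ?A] by force
          from P(4)[OF this] have "P x = 0" using 2 by (simp add: linear_0[OF i])
          then show ?thesis using 2 us by (simp add: linear_0[OF i])
        qed
      qed
      ultimately show ?thesis by (intro exI[of _ ?R]) auto
    qed
    then have "\<exists>R. linear R \<and> (\<forall>x. R x \<in> range u \<and> norm (R x) \<le> C * p x) \<and> (\<forall>(x, z)\<in>?\<Phi>. R x = z)"
      by (rule bounded_operators_finite_intersection[OF W])
    then obtain R where R: "linear R" "\<And>x. R x \<in> range u" "\<And>x. norm (R x) \<le> C * p x"
      and R\<Phi>: "\<forall>(x, z)\<in>?\<Phi>. R x = z"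
      by blast
    have Ri: "R (i e) = 0" for e using bspec[OF R\<Phi>, of "(i e, 0)"] by auto
    have Rs: "R (s f) = f" if "f \<in> F" for f using bspec[OF R\<Phi>, of "(s f, f)"] that by auto
    have ker: "R x = 0" if qx: "q x = 0" for x
    proof -
      obtain e where "p (x - i e) = 0" using kernel[OF qx] by blast
      then have "R (x - i e) = 0" using R(3)[of "x - i e"] by simp
      then show ?thesis using Ri by (simp add: linear_diff[OF R(1)])
    qed
    have eq: "R x = R y" if "q x = q y" for x y
      using ker[of "x - y"] that by (simp add: linear_diff[OF R(1)] linear_diff[OF q])
    obtain l where l: "\<And>z. q (l z) = z" "\<And>z. p (l z) \<le> K * norm z" using lift by metis
    let ?R = "\<lambda>z. R (l z)"
    have add: "?R (a + b) = ?R a + ?R b" for a b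
      using eq[of "l (a + b)" "l a + l b"] by (simp add: l linear_add[OF q] linear_add[OF R(1)])
    have sc: "?R (c *\<^sub>R a) = c *\<^sub>R ?R a" for c a
      using eq[of "l (c *\<^sub>R a)" "c *\<^sub>R l a"] by (simp add: l linear_scale[OF q] linear_scale[OF R(1)])
    have lin: "linear ?R" by (rule linearI) (rule add sc)+
    have bd: "norm (?R z) \<le> C * K * norm z" for z
      using order_trans[OF R(3) mult_left_mono[OF l(2) pos(3)], of z] by (simp add: mult.assoc)
    have "bounded_linear ?R"
      using bd by (intro bounded_linear_intro[where K="C * K"] add sc) (simp add: mult.commute)
    moreover have "fin_dim (range ?R)"
      by (rule fin_dim_subset[OF W linear_subspace_image[OF lin subspace_UNIV]]) (use R(2) in auto)
    moreover have "onorm ?R \<le> C * K"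
      by (rule onorm_bound) (use bd pos K in auto)
    moreover have "?R f = f" if "f \<in> F" for f
      using eq[of "l f" "s f"] Rs[OF that] qs[OF that] l by simp
    ultimately show ?thesis by blast
  qed
  then have "lambda_BAP TYPE('z) (max 1 (C * K))"
    unfolding lambda_BAP_def by (metis max.cobounded1 max.coboundedI2)
  then show ?thesis by (auto simp: BAP_def)
qed

text \<open>
  The operator \<open>V = s T q\<close> fixes \<open>F\<close> up to elements of \<open>E\<close>; adding \<open>P (1 - V)\<close> removes the error.
\<close>

lemma BAP_extension:
  assumes M: "finite_rank_extension TYPE('x) TYPE('e) M" and "BAP TYPE('z)"
  shows "seminorm_BAP p"
proof -
  obtain L where L: "L \<ge> 1" and T: "\<And>F::'z set. fin_dim F \<Longrightarrow>
     \<exists>T. bounded_linear T \<and> fin_dim (range T) \<and> onorm T \<le> L \<and> (\<forall>f\<in>F. T f = f)"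
    using assms(2) unfolding BAP_def lambda_BAP_def by blast
  have M0: "M \<ge> 0" using M by (simp add: finite_rank_extension_def)
  define S where "S = 2 * (1 + K * (M * K)) * K"
  define v where "v = S * (L * K)"
  have pos: "S \<ge> 0" "v \<ge> 0" using K M0 L by (simp_all add: S_def v_def)
  have "\<exists>T. linear T \<and> fin_dim (range T) \<and> (\<forall>x. p (T x) \<le> (v + K * (M * K) * (1 + v)) * p x)
      \<and> (\<forall>f\<in>F. p (T f - f) = 0)"
    if F: "fin_dim F" for F :: "'x set"
  proof -
    obtain H where H: "finite H" "F = span H" using F by (auto simp: fin_dim_def)
    obtain T where T: "bounded_linear T" "fin_dim (range T)" "onorm T \<le> L" "\<And>f. f \<in> q ` F \<Longrightarrow> T f = f"
      using T[OF fin_dim_linear_image[OF q F]] by blast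
    have Tl: "linear T" using T(1) bounded_linear.linear by blast
    have Tb: "norm (T z) \<le> L * norm z" for z
      using onorm[OF T(1), of z] mult_right_mono[OF T(3) norm_ge_zero[of z]] by linarith
    obtain s where s: "linear s" and qs: "\<And>w. w \<in> range T \<Longrightarrow> q (s w) = w"
      and ps: "\<And>w. w \<in> range T \<Longrightarrow> p (s w) \<le> S * norm w"
      using uniform_lifting[OF M T(2)] unfolding S_def by blast
    define V where "V x = s (T (q x))" for x
    have V: "linear V"
      unfolding V_def
      using linear_compose[OF linear_compose[OF q Tl] s] by (simp add: o_def)
    have Vb: "p (V x) \<le> v * p x" for x
    proof -
      have "p (V x) \<le> S * norm (T (q x))" unfolding V_def by (rule ps) simp
      also have "\<dots> \<le> S * (L * (K * p x))"
        using order_trans[OF Tb mult_left_mono[OF q_bound]] L by (intro mult_left_mono pos) auto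
      finally show ?thesis by (simp add: v_def mult.assoc)
    qed
    have "q (x - V x) = 0" if "x \<in> F" for x
      using qs[of "T (q x)"] T(4)[of "q x"] that rangeI[of T "q x"] by (simp add: V_def linear_diff[OF q])
    then have "\<exists>e. p (x - V x - i e) = 0" if "x \<in> F" for x
      using kernel that by blast
    then obtain e where e: "\<And>x. x \<in> F \<Longrightarrow> p (x - V x - i (e x)) = 0" by metis
    have B: "fin_dim (span (e ` H))" using H(1) by (intro fin_dim_span) simp
    obtain P where P: "linear P" "fin_dim (range P)" "\<And>x. norm (P x) \<le> M * K * p x"
      and Pe: "\<And>y. y \<in> span (e ` H) \<Longrightarrow> P (i y) = y"
      using local_projection[OF M B] by blast
    define T' where "T' x = V x + i (P (x - V x))" for x
    have id: "linear (\<lambda>x. x - V x)"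
      by (intro linear_compose_sub linear_id[unfolded id_def] V)
    have T': "linear T'"
      unfolding T'_def
      using linear_compose_add[OF V linear_compose[OF linear_compose[OF id P(1)] i]] by (simp add: o_def)
    have T'b: "p (T' x) \<le> (v + K * (M * K) * (1 + v)) * p x" for x
    proof -
      have "p (T' x) \<le> p (V x) + p (i (P (x - V x)))" unfolding T'_def by (rule seminorm_add[OF p])
      moreover have "p (i (P (x - V x))) \<le> K * (M * K * p (x - V x))"
        using order_trans[OF i_bound mult_left_mono[OF P(3)]] K by simp
      moreover have "p (x - V x) \<le> p x + v * p x" using seminorm_diff[OF p, of x "V x"] Vb[of x] by simp
      then have "K * (M * K * p (x - V x)) \<le> K * (M * K * (p x + v * p x))"
        using K M0 by (intro mult_left_mono) auto
      ultimately have "p (T' x) \<le> v * p x + K * (M * K * (p x + v * p x))" using Vb[of x] by linarith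
      then show ?thesis by (simp add: algebra_simps)
    qed
    have "fin_dim {a + b |a b. a \<in> s ` range T \<and> b \<in> i ` range P}"
      by (intro fin_dim_sums fin_dim_linear_image s i T P)
    then have T'f: "fin_dim (range T')"
      by (rule fin_dim_subset[OF _ linear_subspace_image[OF T' subspace_UNIV]])
        (use rangeI in \<open>force simp: T'_def V_def\<close>)
    have "subspace {x. p (T' x - x) = 0}"
    proof (rule subspaceI)
      show "0 \<in> {x. p (T' x - x) = 0}" by (simp add: linear_0[OF T'] seminorm_zero[OF p])
    next
      fix x y assume "x \<in> {x. p (T' x - x) = 0}" "y \<in> {x. p (T' x - x) = 0}"
      then have "p ((T' x - x) + (T' y - y)) \<le> 0" using seminorm_add[OF p, of "T' x - x" "T' y - y"] by simp
      then have "p ((T' x - x) + (T' y - y)) = 0" using p_nonneg by (metis order_antisym)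
      then show "x + y \<in> {x. p (T' x - x) = 0}" by (simp add: linear_add[OF T'] algebra_simps)
    next
      fix c x assume "x \<in> {x. p (T' x - x) = 0}"
      then have "p (c *\<^sub>R (T' x - x)) = 0" by (simp add: seminorm_scale[OF p])
      then show "c *\<^sub>R x \<in> {x. p (T' x - x) = 0}" by (simp add: linear_scale[OF T'] algebra_simps)
    qed
    moreover have "H \<subseteq> {x. p (T' x - x) = 0}"
    proof
      fix x assume x: "x \<in> H"
      let ?d = "x - V x - i (e x)"
      have d0: "p ?d = 0" using e x H by (simp add: span_base)
      then have "P ?d = 0" using P(3)[of ?d] by simp
      then have "P (x - V x) = e x"
        using Pe[of "e x"] x by (simp add: linear_diff[OF P(1)] span_base)
      then have "T' x - x = - ?d" by (simp add: T'_def)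
      then have "p (T' x - x) = 0" by (simp only: seminorm_minus[OF p] d0)
      then show "x \<in> {x. p (T' x - x) = 0}" by simp
    qed
    ultimately have "F \<subseteq> {x. p (T' x - x) = 0}" using H by (simp add: span_minimal)
    then show ?thesis using T' T'f T'b by (intro exI[of _ T']) auto
  qed
  moreover have "0 \<le> v + K * (M * K) * (1 + v)" using pos K M0 by simp
  ultimately show ?thesis unfolding seminorm_BAP_def by blast
qed

end

section \<open>The pushout of two embeddings\<close>

text \<open>
  The quotient seminorm on the product, for the subspace of all \<open>(j y, - j' y)\<close>.
\<close>

definition pushout_norm ::
    "('y::real_normed_vector \<Rightarrow> 'a::real_normed_vector) \<Rightarrow> ('y \<Rightarrow> 'b::real_normed_vector) \<Rightarrow> 'a \<times> 'b \<Rightarrow> real" where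
  "pushout_norm j j' x = (INF y. norm (fst x + j y) + norm (snd x - j' y))"

lemma pushout_norm_le: "pushout_norm j j' x \<le> norm (fst x + j y) + norm (snd x - j' y)"
  unfolding pushout_norm_def by (rule cINF_lower) (auto intro!: bdd_belowI2[where m=0])

lemma pushout_norm_ge:
  "(\<And>y. c \<le> norm (fst x + j y) + norm (snd x - j' y)) \<Longrightarrow> c \<le> pushout_norm j j' x"
  unfolding pushout_norm_def by (rule cINF_greatest) auto

lemma seminorm_pushout_norm:
  assumes j: "linear j" and j': "linear j'"
  shows "seminorm (pushout_norm j j')"
proof -
  let ?p = "pushout_norm j j'"
  let ?v = "\<lambda>x y. norm (fst x + j y) + norm (snd x - j' y)"
  have add: "?p (a + b) \<le> ?p a + ?p b" for a b
  proof -
    have *: "?p (a + b) - ?v b z \<le> ?v a y" for y z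
    proof -
      have "?p (a + b) \<le> ?v (a + b) (y + z)" by (rule pushout_norm_le)
      also have "?v (a + b) (y + z) = norm ((fst a + j y) + (fst b + j z)) + norm ((snd a - j' y) + (snd b - j' z))"
        by (simp add: linear_add[OF j] linear_add[OF j'] algebra_simps)
      also have "\<dots> \<le> ?v a y + ?v b z"
        using norm_triangle_ineq[of "fst a + j y" "fst b + j z"]
          norm_triangle_ineq[of "snd a - j' y" "snd b - j' z"] by linarith
      finally show ?thesis by simp
    qed
    have **: "?p (a + b) - ?v b z \<le> ?p a" for z by (rule pushout_norm_ge) (rule *)
    have "?p (a + b) - ?p a \<le> ?p b"
    proof (rule pushout_norm_ge)
      show "?p (a + b) - ?p a \<le> ?v b z" for z using **[of z] by linarith
    qed
    then show ?thesis by simp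
  qed
  have nonneg: "0 \<le> ?p x" for x by (rule pushout_norm_ge) simp
  have le: "?p (c *\<^sub>R x) \<le> \<bar>c\<bar> * ?p x" if c: "c \<noteq> 0" for c x
  proof -
    have "?p (c *\<^sub>R x) / \<bar>c\<bar> \<le> ?p x"
    proof (rule pushout_norm_ge)
      fix y
      have "?p (c *\<^sub>R x) \<le> ?v (c *\<^sub>R x) (c *\<^sub>R y)" by (rule pushout_norm_le)
      also have "\<dots> = norm (c *\<^sub>R (fst x + j y)) + norm (c *\<^sub>R (snd x - j' y))"
        by (simp only: fst_scaleR snd_scaleR linear_scale[OF j] linear_scale[OF j']
            scaleR_add_right scaleR_diff_right)
      also have "\<dots> = \<bar>c\<bar> * ?v x y" by (simp add: distrib_left)
      finally show "?p (c *\<^sub>R x) / \<bar>c\<bar> \<le> ?v x y" using c by (simp add: field_simps)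
    qed
    then show ?thesis using c by (simp add: field_simps)
  qed
  have "?p (c *\<^sub>R x) = \<bar>c\<bar> * ?p x" for c x
  proof (cases "c = 0")
    case True
    have "?p 0 \<le> 0" using pushout_norm_le[of j j' 0 0] by (simp add: linear_0[OF j] linear_0[OF j'])
    then show ?thesis using True nonneg[of 0] by simp
  next
    case False
    have "?p ((1/c) *\<^sub>R (c *\<^sub>R x)) \<le> \<bar>1/c\<bar> * ?p (c *\<^sub>R x)" using False by (intro le) simp
    then have "\<bar>c\<bar> * ?p x \<le> ?p (c *\<^sub>R x)" using False by (simp add: field_simps)
    then show ?thesis using le[OF False, of x] by simp
  qed
  then show ?thesis using add by (simp add: seminorm_def)
qed

lemma pushout_norm_swap_le:
  assumes j: "linear j" and j': "linear j'"
  shows "pushout_norm j' j (prod.swap x) \<le> pushout_norm j j' x"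
proof (rule pushout_norm_ge)
  show "pushout_norm j' j (prod.swap x) \<le> norm (fst x + j y) + norm (snd x - j' y)" for y
    using pushout_norm_le[of j' j "prod.swap x" "- y"]
    by (simp add: linear_neg[OF j] linear_neg[OF j'] add.commute)
qed

lemma pushout_norm_swap:
  assumes "linear j" "linear j'"
  shows "pushout_norm j' j (prod.swap x) = pushout_norm j j' x"
  using pushout_norm_swap_le[OF assms, of x] pushout_norm_swap_le[OF assms(2,1), of "prod.swap x"] by simp

text \<open>
  The open mapping theorem for \<open>j\<close>, whose range is the closed kernel of \<open>q\<close>, and for \<open>q\<close>; one constant
  serves for all four bounds.
\<close>

lemma short_exact_bounds:
  fixes j :: "'y::banach \<Rightarrow> 'e::banach" and q :: "'e \<Rightarrow> 'z::banach"
  assumes "short_exact j q"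
  shows "\<exists>C>0. (\<forall>y. norm (j y) \<le> C * norm y) \<and> (\<forall>y. norm y \<le> C * norm (j y)) \<and>
    (\<forall>e. norm (q e) \<le> C * norm e) \<and> (\<forall>z. \<exists>e. q e = z \<and> norm e \<le> C * norm z)"
proof -
  have j: "bounded_linear j" and q: "bounded_linear q" and inj: "{y. j y = 0} = {0}"
    and ker: "{x. q x = 0} = range j" and onto: "range q = UNIV"
    using assms by (auto simp: short_exact_def)
  have "closed {x. q x = 0}"
    by (intro closed_Collect_eq continuous_intros linear_continuous_on q)
  then obtain A where A: "A > 0" "\<And>x. x \<in> range j \<Longrightarrow> \<exists>y. j y = x \<and> norm y \<le> A * norm x"
    using open_mapping_closed_range[OF j] unfolding ker by blast
  have "closed (range q)" by (simp add: onto)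
  then obtain B where B: "B > 0" "\<And>z. z \<in> range q \<Longrightarrow> \<exists>e. q e = z \<and> norm e \<le> B * norm z"
    using open_mapping_closed_range[OF q] by blast
  obtain J where J: "J > 0" "\<And>y. norm (j y) \<le> norm y * J" using bounded_linear.pos_bounded[OF j] by blast
  obtain Q where Q: "Q > 0" "\<And>e. norm (q e) \<le> norm e * Q" using bounded_linear.pos_bounded[OF q] by blast
  have low: "norm y \<le> A * norm (j y)" for y
  proof -
    obtain y' where y': "j y' = j y" "norm y' \<le> A * norm (j y)" using A(2)[of "j y"] by blast
    have "y' - y \<in> {y. j y = 0}" using y'(1) by (simp add: linear_diff[OF bounded_linear.linear[OF j]])
    then show ?thesis using y'(2) inj by simp
  qed
  let ?C = "A + B + J + Q"
  have C: "A * norm x \<le> ?C * norm x" "B * norm x \<le> ?C * norm x"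
    "norm x * J \<le> ?C * norm x" "norm x * Q \<le> ?C * norm x" for x :: "'v::real_normed_vector"
    using A(1) B(1) J(1) Q(1) by (simp_all add: algebra_simps add_nonneg_nonneg)
  show ?thesis
  proof (intro exI[of _ ?C] conjI allI)
    show "?C > 0" using A(1) B(1) J(1) Q(1) by simp
    show "norm (j y) \<le> ?C * norm y" for y using J(2) C(3) by (rule order_trans)
    show "norm y \<le> ?C * norm (j y)" for y using low C(1) by (rule order_trans)
    show "norm (q e) \<le> ?C * norm e" for e using Q(2) C(4) by (rule order_trans)
    show "\<exists>e. q e = z \<and> norm e \<le> ?C * norm z" for z
      using B(2)[of z] C(2)[of z] onto by (metis UNIV_I order_trans)
  qed
qed

text \<open>
  The norm on \<open>E\<close> is equivalent to the pushout seminorm because \<open>\<parallel>j y\<parallel> \<le> C D \<parallel>j' y\<parallel>\<close>: a vector \<open>j y\<close>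
  added to \<open>e\<close> must be paid for in the second component.
\<close>

lemma pushout_extension_fst:
  fixes j :: "'y::banach \<Rightarrow> 'e::banach" and q :: "'e \<Rightarrow> 'z::banach"
    and j' :: "'y \<Rightarrow> 'e1::banach" and q' :: "'e1 \<Rightarrow> 'z1::banach"
  assumes jq: "short_exact j q" and jq': "short_exact j' q'"
  obtains K where "seminormed_extension (pushout_norm j j') (\<lambda>e. (e, 0)) (\<lambda>x. q' (snd x)) K"
proof -
  obtain C where C: "C > 0" "\<And>y. norm (j y) \<le> C * norm y"
    using short_exact_bounds[OF jq] by blast
  obtain D where D: "D > 0" "\<And>y. norm (j' y) \<le> D * norm y" "\<And>y. norm y \<le> D * norm (j' y)"
    "\<And>e. norm (q' e) \<le> D * norm e" "\<And>z. \<exists>e. q' e = z \<and> norm e \<le> D * norm z"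
    using short_exact_bounds[OF jq'] by blast
  have j: "linear j" and j': "linear j'" and q': "linear q'"
    and ker': "\<And>e. q' e = 0 \<longleftrightarrow> e \<in> range j'"
    using jq jq' by (auto simp: short_exact_def intro: bounded_linear.linear)
  let ?p = "pushout_norm j j'"
  note p = seminorm_pushout_norm[OF j j']
  let ?K = "1 + C * D + D"
  have K: "?K > 0" "1 \<le> ?K" "D \<le> ?K" "1 + C * D \<le> ?K" using C(1) D(1) by (simp_all add: add_pos_pos)
  have "seminormed_extension ?p (\<lambda>e. (e, 0)) (\<lambda>x. q' (snd x)) ?K"
  proof (rule seminormed_extension.intro)
    show "seminorm ?p" by (rule p)
    show "linear (\<lambda>e. (e :: 'e, 0 :: 'e1))" by (rule linearI) simp_all
    show "linear (\<lambda>x :: 'e \<times> 'e1. q' (snd x))" using linear_compose[OF linear_snd q'] by (simp add: o_def)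
    show "0 < ?K" by (rule K)
  next
    fix e :: 'e
    have "norm e / ?K \<le> ?p (e, 0)"
    proof (rule pushout_norm_ge)
      fix y
      let ?a = "norm (e + j y)" and ?b = "norm (j' y)"
      have "norm e \<le> ?a + norm (j y)" using norm_triangle_ineq4[of "e + j y" "j y"] by simp
      also have "norm (j y) \<le> C * (D * ?b)"
        using order_trans[OF C(2) mult_left_mono[OF D(3)]] C(1) by simp
      finally have "norm e \<le> 1 * ?a + (C * D) * ?b" by simp
      also have "\<dots> \<le> ?K * ?a + ?K * ?b"
        using K(2) C(1) D(1) by (intro add_mono mult_right_mono) auto
      finally show "norm e / ?K \<le> norm (fst (e, 0) + j y) + norm (snd (e, 0) - j' y)"
        using K(1) by (simp add: pos_divide_le_eq algebra_simps)
    qed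
    then show "norm e \<le> ?K * ?p (e, 0)" using K(1) by (simp add: pos_divide_le_eq mult.commute)
    have "?p (e, 0) \<le> norm e"
      using pushout_norm_le[of j j' "(e, 0)" 0] by (simp add: linear_0[OF j] linear_0[OF j'])
    also have "\<dots> \<le> ?K * norm e" using mult_right_mono[OF K(2) norm_ge_zero[of e]] by simp
    finally show "?p (e, 0) \<le> ?K * norm e" .
    show "q' (snd (e, 0)) = 0" by (simp add: linear_0[OF q'])
  next
    fix x :: "'e \<times> 'e1"
    have "norm (q' (snd x)) / ?K \<le> ?p x"
    proof (rule pushout_norm_ge)
      fix y
      have "q' (j' y) = 0" using ker' by blast
      then have "norm (q' (snd x)) \<le> D * norm (snd x - j' y)"
        using D(4)[of "snd x - j' y"] by (simp add: linear_diff[OF q'])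
      also have "\<dots> \<le> ?K * (norm (fst x + j y) + norm (snd x - j' y))"
        using K D(1) by (intro mult_mono) auto
      finally show "norm (q' (snd x)) / ?K \<le> norm (fst x + j y) + norm (snd x - j' y)"
        using K(1) by (simp add: pos_divide_le_eq mult.commute)
    qed
    then show "norm (q' (snd x)) \<le> ?K * ?p x" using K(1) by (simp add: pos_divide_le_eq mult.commute)
    assume "q' (snd x) = 0"
    then obtain y where y: "snd x = j' y" using ker' by blast
    \<comment> \<open>shifting by \<open>y\<close> moves \<open>x\<close> into the first component\<close>
    have "?p (x - (fst x + j y, 0)) \<le> 0"
      using pushout_norm_le[of j j' "x - (fst x + j y, 0)" y] y by simp
    then show "\<exists>e. ?p (x - (e, 0)) = 0"
      using seminorm_nonneg[OF p] by (metis order_antisym)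
  next
    fix z
    obtain e where e: "q' e = z" "norm e \<le> D * norm z" using D(5) by blast
    have "?p (0, e) \<le> norm e"
      using pushout_norm_le[of j j' "(0, e)" 0] by (simp add: linear_0[OF j] linear_0[OF j'])
    also have "\<dots> \<le> ?K * norm z"
      using e(2) mult_right_mono[OF K(3) norm_ge_zero[of z]] by simp
    finally show "\<exists>x. q' (snd x) = z \<and> ?p x \<le> ?K * norm z"
      using e(1) by (intro exI[of _ "(0, e)"]) simp
  qed
  then show ?thesis using that by blast
qed

lemma pushout_extension_snd:
  fixes j :: "'y::banach \<Rightarrow> 'e::banach" and q :: "'e \<Rightarrow> 'z::banach"
    and j' :: "'y \<Rightarrow> 'e1::banach" and q' :: "'e1 \<Rightarrow> 'z1::banach"
  assumes jq: "short_exact j q" and jq': "short_exact j' q'"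
  obtains K where "seminormed_extension (pushout_norm j j') (\<lambda>e. (0, e)) (\<lambda>x. q (fst x)) K"
proof -
  have j: "linear j" "linear j'"
    using jq jq' by (auto simp: short_exact_def intro: bounded_linear.linear)
  obtain K where "seminormed_extension (pushout_norm j' j) (\<lambda>e. (e, 0)) (\<lambda>x. q (snd x)) K"
    using pushout_extension_fst[OF jq' jq] by blast
  then interpret E: seminormed_extension "pushout_norm j' j" "\<lambda>e. (e, 0)" "\<lambda>x. q (snd x)" K .
  have s: "pushout_norm j j' (a, b) = pushout_norm j' j (b, a)" for a b
    using pushout_norm_swap[OF j, of "(a, b)"] by simp
  have "linear q" using jq by (auto simp: short_exact_def intro: bounded_linear.linear)
  have "seminormed_extension (pushout_norm j j') (\<lambda>e. (0, e)) (\<lambda>x. q (fst x)) K"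
  proof (rule seminormed_extension.intro)
    show "seminorm (pushout_norm j j')" by (rule seminorm_pushout_norm[OF j])
    show "linear (\<lambda>e. (0 :: 'e, e :: 'e1))" by (rule linearI) simp_all
    show "linear (\<lambda>x :: 'e \<times> 'e1. q (fst x))" using linear_compose[OF linear_fst \<open>linear q\<close>] by (simp add: o_def)
    show "0 < K" by (rule E.K)
    show "norm e \<le> K * pushout_norm j j' (0, e)" "pushout_norm j j' (0, e) \<le> K * norm e"
      "q (fst (0, e)) = 0" for e
      using E.embed[of e] E.i_bound[of e] E.q_i[of e] by (simp_all add: s)
    show "norm (q (fst x)) \<le> K * pushout_norm j j' x" for x
      using E.q_bound[of "prod.swap x"] by (cases x) (simp add: s)
    show "\<exists>e. pushout_norm j j' (x - (0, e)) = 0" if "q (fst x) = 0" for x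
      using E.kernel[of "prod.swap x"] that by (cases x) (simp add: s)
    show "\<exists>x. q (fst x) = z \<and> pushout_norm j j' x \<le> K * norm z" for z
    proof -
      obtain x where "q (snd x) = z" "pushout_norm j' j x \<le> K * norm z" using E.lift by blast
      then show ?thesis by (intro exI[of _ "prod.swap x"]) (simp add: pushout_norm_swap[OF j(2,1)])
    qed
  qed
  then show ?thesis using that by blast
qed

text \<open>
  The pushout inherits the BAP from \<open>Z\<close>, since it extends \<open>Z\<close> by \<open>E'\<close>, and passes it on to \<open>Z'\<close>, which is
  its quotient by \<open>E\<close>.
\<close>

lemma BAP_quotient_transfer:
  fixes j :: "'y::banach \<Rightarrow> 'e::banach" and q :: "'e \<Rightarrow> 'z::banach"
    and j' :: "'y \<Rightarrow> 'e1::banach" and q' :: "'e1 \<Rightarrow> 'z1::banach"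
  assumes E: "L_infty_space TYPE('e)" and E': "L_infty_space TYPE('e1)"
    and jq: "short_exact j q" and jq': "short_exact j' q'" and Z: "BAP TYPE('z)"
  shows "BAP TYPE('z1)"
proof -
  obtain M where M: "finite_rank_extension TYPE('e \<times> 'e1) TYPE('e) M"
    using L_infty_space_extension[OF E] by blast
  obtain M' where M': "finite_rank_extension TYPE('e \<times> 'e1) TYPE('e1) M'"
    using L_infty_space_extension[OF E'] by blast
  obtain K where "seminormed_extension (pushout_norm j j') (\<lambda>e. (0, e)) (\<lambda>x. q (fst x)) K"
    using pushout_extension_snd[OF jq jq'] by blast
  from seminormed_extension.BAP_extension[OF this M' Z] have PO: "seminorm_BAP (pushout_norm j j')" .
  obtain K' where "seminormed_extension (pushout_norm j j') (\<lambda>e. (e, 0)) (\<lambda>x. q' (snd x)) K'"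
    using pushout_extension_fst[OF jq jq'] by blast
  from seminormed_extension.BAP_quotient[OF this M PO] show ?thesis .
qed

theorem proposition3p2:
  fixes j :: "'y::banach \<Rightarrow> 'e::banach" and q :: "'e \<Rightarrow> 'z::banach"
    and j' :: "'y \<Rightarrow> 'e1::banach" and q' :: "'e1 \<Rightarrow> 'z1::banach"
  assumes "L_infty_space TYPE('e)" and "L_infty_space TYPE('e1)"
    and "short_exact j q" and "short_exact j' q'"
  shows "BAP TYPE('z) \<longleftrightarrow> BAP TYPE('z1)"
  using BAP_quotient_transfer[OF assms] BAP_quotient_transfer[OF assms(2,1,4,3)] by blast

end
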